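(* Let $S$ be a discrete semigroup, and let $E\subseteq\ell^\infty(S)$ be a Hopf algebra predual for $\ell^1(S)$. Then $E$ is a C$^*$-subalgebra of $\ell^\infty(S)$. Let $K$ be the character space of $E$. Then the canonical map $S\to K$, sending $s$ to the evaluation functional $x\mapsto\langle x,\delta_s\rangle=x(s)$ on $E$, is a bijection. Use this bijection to turn $K$ into a semigroup. Then: (1) $K$ is a semitopological semigroup; (2) for each $s\in K$ and each compact $L\subseteq K$, the sets $\{t\in K: st\in L\}$ and $\{t\in K: ts\in L\}$ are compact. Moreover, this structure on $K$ completely determines $E$: if $F\subseteq\ell^\infty(S)$ is another Hopf algebra predual for $\ell^1(S)$, with character space $K'$, and the composite bijection $K\to S\to K'$ of the canonical bijections is a homeomorphism (it is automatically a semigroup isomorphism), then $E=F$.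
   Context: For a semigroup $S$ (discrete), $\ell^1(S)$ is the complex convolution Banach algebra with standard unit vectors $(\delta_s)_{s\in S}$ and product determined by $\delta_s\delta_t=\delta_{st}$; its dual is identified with $\ell^\infty(S)$, with bimodule actions $(\delta_s\cdot f)(t)=f(ts)$ and $(f\cdot\delta_s)(t)=f(st)$. A predual of a Banach algebra $A$ is a norm-closed sub-bimodule $E\subseteq A^*$ which is a Banach space predual of $A$, i.e. the canonical map $A\to E^*$, $a\mapsto(\mu\mapsto\mu(a))$, is a linear isomorphism (bijective and bicontinuous, not necessarily isometric). A Hopf algebra predual of $\ell^1(S)$ is a predual $E\subseteq\ell^\infty(S)$ which is also a subalgebra of $\ell^\infty(S)$ for the pointwise product. The character space of a commutative Banach algebra carries the weak$^*$ (Gelfand) topology. A semigroup carrying a topology is semitopological if its product is separately continuous. *)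

theory Defs
  imports "HOL-Analysis.Analysis"
begin

text \<open>
  The library has no class of complex normed spaces, and the dual of a subspace that is not a whole
  type cannot be a type. Hence every complex normed space below is a set \<open>V\<close> of functions
  \<open>'i \<Rightarrow> complex\<close> with pointwise operations, together with a norm \<open>n\<close> that matters only on \<open>V\<close>.
\<close>

definition complex_subspace :: "('i \<Rightarrow> complex) set \<Rightarrow> bool" where
  "complex_subspace V \<longleftrightarrow>
     (\<lambda>i. 0) \<in> V \<and> (\<forall>x\<in>V. \<forall>y\<in>V. (\<lambda>i. x i + y i) \<in> V) \<and> (\<forall>c. \<forall>x\<in>V. (\<lambda>i. c * x i) \<in> V)"

definition complex_linear_on :: "('i \<Rightarrow> complex) set \<Rightarrow> (('i \<Rightarrow> complex) \<Rightarrow> complex) \<Rightarrow> bool" where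
  "complex_linear_on V \<phi> \<longleftrightarrow>
     (\<forall>x\<in>V. \<forall>y\<in>V. \<phi> (\<lambda>i. x i + y i) = \<phi> x + \<phi> y) \<and> (\<forall>c. \<forall>x\<in>V. \<phi> (\<lambda>i. c * x i) = c * \<phi> x)"

text \<open>
  The distance is set to \<open>0\<close> off \<open>V\<close> because \<^const>\<open>Metric_space\<close> constrains it on the whole type,
  whereas a norm given by a supremum has no meaning for unbounded functions.
\<close>

definition norm_dist ::
  "('i \<Rightarrow> complex) set \<Rightarrow> (('i \<Rightarrow> complex) \<Rightarrow> real) \<Rightarrow> ('i \<Rightarrow> complex) \<Rightarrow> ('i \<Rightarrow> complex) \<Rightarrow> real"
  where "norm_dist V n x y = (if x \<in> V \<and> y \<in> V then n (\<lambda>i. x i - y i) else 0)"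

definition norm_topology ::
  "('i \<Rightarrow> complex) set \<Rightarrow> (('i \<Rightarrow> complex) \<Rightarrow> real) \<Rightarrow> ('i \<Rightarrow> complex) topology"
  where "norm_topology V n = Metric_space.mtopology V (norm_dist V n)"


subsection \<open>The Banach algebra \<open>\<ell>\<^sup>1(S)\<close> and its dual bimodule \<open>\<ell>\<^sup>\<infinity>(S)\<close>\<close>

definition ell1 :: "('s \<Rightarrow> complex) set" where
  "ell1 = {a. (\<lambda>s. cmod (a s)) summable_on UNIV}"

definition ell1_norm :: "('s \<Rightarrow> complex) \<Rightarrow> real" where
  "ell1_norm a = (\<Sum>\<^sub>\<infinity>s. cmod (a s))"

definition unit_vec :: "'s \<Rightarrow> 's \<Rightarrow> complex" where
  "unit_vec s = (\<lambda>t. if t = s then 1 else 0)"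

definition ell1_conv ::
  "('s::semigroup_mult \<Rightarrow> complex) \<Rightarrow> ('s \<Rightarrow> complex) \<Rightarrow> 's \<Rightarrow> complex" where
  "ell1_conv a b = (\<lambda>u. \<Sum>\<^sub>\<infinity>(s, t)\<in>{(s, t). s * t = u}. a s * b t)"

definition linf :: "('s \<Rightarrow> complex) set" where
  "linf = {f. bounded (range f)}"

definition sup_norm :: "('s \<Rightarrow> complex) \<Rightarrow> real" where
  "sup_norm f = (SUP s. cmod (f s))"

definition pairing :: "('s \<Rightarrow> complex) \<Rightarrow> ('s \<Rightarrow> complex) \<Rightarrow> complex" where
  "pairing f a = (\<Sum>\<^sub>\<infinity>s. f s * a s)"

text \<open>
  The dual bimodule structure is given by \<open>\<langle>a \<cdot> f, b\<rangle> = \<langle>f, b a\<rangle>\<close> and \<open>\<langle>f \<cdot> a, b\<rangle> = \<langle>f, a b\<rangle>\<close>; an element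
  of the dual is represented in \<open>\<ell>\<^sup>\<infinity>(S)\<close> by its values at the unit vectors \<open>b = \<delta>\<^sub>t\<close>.
\<close>

definition left_act ::
  "('s::semigroup_mult \<Rightarrow> complex) \<Rightarrow> ('s \<Rightarrow> complex) \<Rightarrow> 's \<Rightarrow> complex" where
  "left_act a f = (\<lambda>t. pairing f (ell1_conv (unit_vec t) a))"

definition right_act ::
  "('s::semigroup_mult \<Rightarrow> complex) \<Rightarrow> ('s \<Rightarrow> complex) \<Rightarrow> 's \<Rightarrow> complex" where
  "right_act f a = (\<lambda>t. pairing f (ell1_conv a (unit_vec t)))"

definition sub_bimodule :: "('s::semigroup_mult \<Rightarrow> complex) set \<Rightarrow> bool" where
  "sub_bimodule E \<longleftrightarrow> E \<subseteq> linf \<and> complex_subspace E \<and>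
     (\<forall>a\<in>ell1. \<forall>f\<in>E. left_act a f \<in> E \<and> right_act f a \<in> E)"


subsection \<open>Preduals\<close>

text \<open>
  Functionals on \<open>E\<close> are \<^const>\<open>extensional\<close>, so that each of them is represented by exactly one
  HOL function.
\<close>

definition dual_space :: "('s \<Rightarrow> complex) set \<Rightarrow> (('s \<Rightarrow> complex) \<Rightarrow> complex) set" where
  "dual_space E = {\<phi> \<in> extensional E. complex_linear_on E \<phi> \<and>
     (\<exists>B. \<forall>f\<in>E. cmod (\<phi> f) \<le> B * sup_norm f)}"

definition dual_norm :: "('s \<Rightarrow> complex) set \<Rightarrow> (('s \<Rightarrow> complex) \<Rightarrow> complex) \<Rightarrow> real" where
  "dual_norm E \<phi> = (SUP f\<in>{f\<in>E. sup_norm f \<le> 1}. cmod (\<phi> f))"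

definition canonical_map ::
  "('s \<Rightarrow> complex) set \<Rightarrow> ('s \<Rightarrow> complex) \<Rightarrow> ('s \<Rightarrow> complex) \<Rightarrow> complex" where
  "canonical_map E a = (\<lambda>f\<in>E. pairing f a)"

text \<open>
  The canonical map is linear by construction; \<^const>\<open>homeomorphic_map\<close> states that it is a bijection
  of \<^const>\<open>ell1\<close> onto \<^const>\<open>dual_space\<close> which is continuous, with continuous inverse, for the norms.
\<close>

definition predual :: "('s::semigroup_mult \<Rightarrow> complex) set \<Rightarrow> bool" where
  "predual E \<longleftrightarrow> sub_bimodule E \<and> closedin (norm_topology linf sup_norm) E \<and>
     homeomorphic_map (norm_topology ell1 ell1_norm) (norm_topology (dual_space E) (dual_norm E))
       (canonical_map E)"

definition hopf_algebra_predual :: "('s::semigroup_mult \<Rightarrow> complex) set \<Rightarrow> bool" where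
  "hopf_algebra_predual E \<longleftrightarrow> predual E \<and> (\<forall>f\<in>E. \<forall>g\<in>E. (\<lambda>s. f s * g s) \<in> E)"

definition cstar_subalgebra :: "('s \<Rightarrow> complex) set \<Rightarrow> bool" where
  "cstar_subalgebra E \<longleftrightarrow> E \<subseteq> linf \<and> complex_subspace E \<and>
     closedin (norm_topology linf sup_norm) E \<and>
     (\<forall>f\<in>E. \<forall>g\<in>E. (\<lambda>s. f s * g s) \<in> E) \<and> (\<forall>f\<in>E. (\<lambda>s. cnj (f s)) \<in> E)"


subsection \<open>Character spaces\<close>

definition character_space :: "('s \<Rightarrow> complex) set \<Rightarrow> (('s \<Rightarrow> complex) \<Rightarrow> complex) set" where
  "character_space E = {\<phi> \<in> extensional E. complex_linear_on E \<phi> \<and>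
     (\<forall>f\<in>E. \<forall>g\<in>E. \<phi> (\<lambda>s. f s * g s) = \<phi> f * \<phi> g) \<and> (\<exists>f\<in>E. \<phi> f \<noteq> 0)}"

text \<open>The weak* topology is the topology of pointwise convergence on \<open>E\<close>.\<close>

definition gelfand_topology :: "('s \<Rightarrow> complex) set \<Rightarrow> (('s \<Rightarrow> complex) \<Rightarrow> complex) topology" where
  "gelfand_topology E = subtopology (product_topology (\<lambda>f. euclidean) E) (character_space E)"

definition point_eval :: "('s \<Rightarrow> complex) set \<Rightarrow> 's \<Rightarrow> ('s \<Rightarrow> complex) \<Rightarrow> complex" where
  "point_eval E s = (\<lambda>f\<in>E. f s)"

text \<open>
  The product of \<open>S\<close> transported along \<^const>\<open>point_eval\<close>; it is meaningful once \<^const>\<open>point_eval\<close> is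
  known to be a bijection onto the character space.
\<close>

definition char_mult ::
  "('s::semigroup_mult \<Rightarrow> complex) set \<Rightarrow> (('s \<Rightarrow> complex) \<Rightarrow> complex) \<Rightarrow>
     (('s \<Rightarrow> complex) \<Rightarrow> complex) \<Rightarrow> ('s \<Rightarrow> complex) \<Rightarrow> complex" where
  "char_mult E k l = point_eval E (inv (point_eval E) k * inv (point_eval E) l)"

definition char_transfer ::
  "('s \<Rightarrow> complex) set \<Rightarrow> ('s \<Rightarrow> complex) set \<Rightarrow>
     (('s \<Rightarrow> complex) \<Rightarrow> complex) \<Rightarrow> ('s \<Rightarrow> complex) \<Rightarrow> complex" where
  "char_transfer E F = point_eval F \<circ> inv (point_eval E)"

definition semitopological_semigroup :: "'k topology \<Rightarrow> ('k \<Rightarrow> 'k \<Rightarrow> 'k) \<Rightarrow> bool" where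
  "semitopological_semigroup X m \<longleftrightarrow>
     (\<forall>x\<in>topspace X. \<forall>y\<in>topspace X. m x y \<in> topspace X) \<and>
     (\<forall>x\<in>topspace X. \<forall>y\<in>topspace X. \<forall>z\<in>topspace X. m (m x y) z = m x (m y z)) \<and>
     (\<forall>x\<in>topspace X. continuous_map X X (m x) \<and> continuous_map X X (\<lambda>y. m y x))"


subsection \<open>Consistency of the definitions\<close>

lemma norm_dist_Metric_space:
  assumes nonneg: "\<And>x y. x \<in> V \<Longrightarrow> y \<in> V \<Longrightarrow> 0 \<le> n (\<lambda>i. x i - y i)"
    and commute: "\<And>x y. x \<in> V \<Longrightarrow> y \<in> V \<Longrightarrow> n (\<lambda>i. x i - y i) = n (\<lambda>i. y i - x i)"
    and zero: "\<And>x y. x \<in> V \<Longrightarrow> y \<in> V \<Longrightarrow> n (\<lambda>i. x i - y i) = 0 \<longleftrightarrow> x = y"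
    and triangle: "\<And>x y z. x \<in> V \<Longrightarrow> y \<in> V \<Longrightarrow> z \<in> V \<Longrightarrow>
      n (\<lambda>i. x i - z i) \<le> n (\<lambda>i. x i - y i) + n (\<lambda>i. y i - z i)"
  shows "Metric_space V (norm_dist V n)"
  by unfold_locales (use assms in \<open>auto simp: norm_dist_def\<close>)

lemma Metric_space_ell1: "Metric_space ell1 (norm_dist ell1 ell1_norm)"
proof (rule norm_dist_Metric_space)
  fix x y z :: "'a \<Rightarrow> complex"
  assume x: "x \<in> ell1" and y: "y \<in> ell1"
  have diff: "(\<lambda>s. cmod (u s - v s)) summable_on UNIV" if "u \<in> ell1" "v \<in> ell1" for u v :: "'a \<Rightarrow> complex"
  proof (rule summable_on_comparison_test)
    show "(\<lambda>s. cmod (u s) + cmod (v s)) summable_on UNIV"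
      using that by (auto simp: ell1_def intro: summable_on_add)
  qed (auto intro: norm_triangle_ineq4)
  show "0 \<le> ell1_norm (\<lambda>i. x i - y i)"
    by (simp add: ell1_norm_def infsum_nonneg)
  show "ell1_norm (\<lambda>i. x i - y i) = ell1_norm (\<lambda>i. y i - x i)"
    by (simp add: ell1_norm_def norm_minus_commute)
  show "ell1_norm (\<lambda>i. x i - y i) = 0 \<longleftrightarrow> x = y"
  proof
    assume 0: "ell1_norm (\<lambda>i. x i - y i) = 0"
    have "cmod (x i - y i) = 0" for i
      using nonneg_infsum_le_0D[of "\<lambda>i. cmod (x i - y i)" UNIV i] 0 diff[OF x y]
      by (simp add: ell1_norm_def)
    then show "x = y" by auto
  qed (simp add: ell1_norm_def)
  assume z: "z \<in> ell1"
  have "ell1_norm (\<lambda>i. x i - z i) \<le> (\<Sum>\<^sub>\<infinity>i. cmod (x i - y i) + cmod (y i - z i))"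
    unfolding ell1_norm_def
    by (intro infsum_mono diff summable_on_add x y z norm_diff_triangle_le[OF order_refl order_refl])
  also have "\<dots> = ell1_norm (\<lambda>i. x i - y i) + ell1_norm (\<lambda>i. y i - z i)"
    unfolding ell1_norm_def by (intro infsum_add diff x y z)
  finally show "ell1_norm (\<lambda>i. x i - z i) \<le> ell1_norm (\<lambda>i. x i - y i) + ell1_norm (\<lambda>i. y i - z i)" .
qed

lemma linf_diff: "u \<in> linf \<Longrightarrow> v \<in> linf \<Longrightarrow> (\<lambda>s. u s - v s) \<in> linf"
  unfolding linf_def by (auto intro: bounded_minus_comp)

lemma norm_le_sup_norm: "f \<in> linf \<Longrightarrow> cmod (f s) \<le> sup_norm f"
  unfolding sup_norm_def linf_def
  by (intro cSUP_upper) (auto simp: bounded_iff bdd_above_def)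

lemma sup_norm_le: "(\<And>s. cmod (f s) \<le> B) \<Longrightarrow> sup_norm f \<le> B"
  unfolding sup_norm_def by (intro cSUP_least) auto

lemma sup_norm_nonneg: "f \<in> linf \<Longrightarrow> 0 \<le> sup_norm f"
  using norm_le_sup_norm[of f undefined] norm_ge_zero order_trans by blast

lemma sup_norm_eq_0: "f \<in> linf \<Longrightarrow> sup_norm f = 0 \<Longrightarrow> f s = 0"
  using norm_le_sup_norm[of f s] by simp

lemma Metric_space_linf: "Metric_space linf (norm_dist linf sup_norm)"
proof (rule norm_dist_Metric_space)
  fix x y z :: "'a \<Rightarrow> complex"
  assume x: "x \<in> linf" and y: "y \<in> linf"
  note xy = linf_diff[OF x y]
  show "0 \<le> sup_norm (\<lambda>i. x i - y i)"
    by (rule sup_norm_nonneg[OF xy])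
  show "sup_norm (\<lambda>i. x i - y i) = sup_norm (\<lambda>i. y i - x i)"
    by (simp add: sup_norm_def norm_minus_commute)
  show "sup_norm (\<lambda>i. x i - y i) = 0 \<longleftrightarrow> x = y"
  proof
    assume "sup_norm (\<lambda>i. x i - y i) = 0"
    then show "x = y" using sup_norm_eq_0[OF xy] by auto
  qed (simp add: sup_norm_def)
  assume z: "z \<in> linf"
  show "sup_norm (\<lambda>i. x i - z i) \<le> sup_norm (\<lambda>i. x i - y i) + sup_norm (\<lambda>i. y i - z i)"
  proof (rule sup_norm_le)
    fix s
    have "cmod (x s - z s) \<le> cmod (x s - y s) + cmod (y s - z s)"
      using norm_triangle_ineq[of "x s - y s" "y s - z s"] by simp
    also have "\<dots> \<le> sup_norm (\<lambda>i. x i - y i) + sup_norm (\<lambda>i. y i - z i)"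
      using norm_le_sup_norm[OF xy, of s] norm_le_sup_norm[OF linf_diff[OF y z], of s] by simp
    finally show "cmod (x s - z s) \<le> \<dots>" .
  qed
qed

lemma Metric_space_dual_space:
  assumes E: "E \<subseteq> linf" "complex_subspace E"
  shows "Metric_space (dual_space E) (norm_dist (dual_space E) (dual_norm E))"
proof (rule norm_dist_Metric_space)
  let ?B = "{f \<in> E. sup_norm f \<le> 1}"
  have zero_in: "(\<lambda>s. 0) \<in> ?B"
    using E by (auto simp: complex_subspace_def sup_norm_def)
  have bdd: "bdd_above ((\<lambda>f. cmod (u f - v f)) ` ?B)" if uv: "u \<in> dual_space E" "v \<in> dual_space E" for u v
  proof -
    obtain A B where A: "\<forall>f\<in>E. cmod (u f) \<le> A * sup_norm f"
      and B: "\<forall>f\<in>E. cmod (v f) \<le> B * sup_norm f"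
      using uv by (auto simp: dual_space_def)
    have "cmod (u f - v f) \<le> \<bar>A\<bar> + \<bar>B\<bar>" if f: "f \<in> ?B" for f
    proof -
      have n: "0 \<le> sup_norm f" "sup_norm f \<le> 1" using f E sup_norm_nonneg by auto
      have "A * sup_norm f \<le> \<bar>A\<bar> * 1" "B * sup_norm f \<le> \<bar>B\<bar> * 1"
        using n by (intro mult_mono; simp)+
      moreover have "cmod (u f - v f) \<le> cmod (u f) + cmod (v f)" by (rule norm_triangle_ineq4)
      ultimately show ?thesis using A B f by force
    qed
    then show ?thesis by (intro bdd_aboveI2)
  qed
  have upper: "cmod (u f - v f) \<le> dual_norm E (\<lambda>f. u f - v f)"
    if "u \<in> dual_space E" "v \<in> dual_space E" "f \<in> ?B" for u v f
    unfolding dual_norm_def by (rule cSUP_upper[OF that(3) bdd[OF that(1,2)]])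
  fix x y z :: "('a \<Rightarrow> complex) \<Rightarrow> complex"
  assume x: "x \<in> dual_space E" and y: "y \<in> dual_space E"
  show "0 \<le> dual_norm E (\<lambda>i. x i - y i)"
    using upper[OF x y zero_in] norm_ge_zero order_trans by blast
  show "dual_norm E (\<lambda>i. x i - y i) = dual_norm E (\<lambda>i. y i - x i)"
    by (simp add: dual_norm_def norm_minus_commute)
  show "dual_norm E (\<lambda>i. x i - y i) = 0 \<longleftrightarrow> x = y"
  proof
    assume "x = y"
    have "(\<lambda>f. cmod 0) ` ?B = {0}" using zero_in by auto
    then show "dual_norm E (\<lambda>i. x i - y i) = 0"
      using \<open>x = y\<close> by (simp add: dual_norm_def)
  next
    assume 0: "dual_norm E (\<lambda>i. x i - y i) = 0"
    have ball: "x f = y f" if "f \<in> ?B" for f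
      using upper[OF x y that] 0 by simp
    have eq: "x f = y f" if f: "f \<in> E" for f
    proof -
      define c where "c = inverse (1 + sup_norm f)"
      have n: "0 \<le> sup_norm f" using f E sup_norm_nonneg by auto
      then have c: "c > 0" by (simp add: c_def)
      have "sup_norm (\<lambda>s. complex_of_real c * f s) \<le> 1"
      proof (rule sup_norm_le)
        fix s
        have "cmod (f s) \<le> 1 + sup_norm f" using norm_le_sup_norm[of f s] f E by force
        then show "cmod (complex_of_real c * f s) \<le> 1"
          using n c unfolding norm_mult norm_of_real by (simp add: c_def field_simps)
      qed
      then have "(\<lambda>s. complex_of_real c * f s) \<in> ?B"
        using f E by (auto simp: complex_subspace_def)
      from ball[OF this] have "complex_of_real c * x f = complex_of_real c * y f"
        using x y f unfolding dual_space_def complex_linear_on_def by simp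
      then show ?thesis using c by simp
    qed
    show "x = y"
      using x y eq by (intro extensionalityI[of _ E]) (auto simp: dual_space_def)
  qed
  assume z: "z \<in> dual_space E"
  show "dual_norm E (\<lambda>i. x i - z i) \<le> dual_norm E (\<lambda>i. x i - y i) + dual_norm E (\<lambda>i. y i - z i)"
    unfolding dual_norm_def[of E "\<lambda>i. x i - z i"]
  proof (rule cSUP_least)
    show "?B \<noteq> {}" using zero_in by auto
    fix f assume f: "f \<in> ?B"
    have "cmod (x f - z f) \<le> cmod (x f - y f) + cmod (y f - z f)"
      using norm_triangle_ineq[of "x f - y f" "y f - z f"] by simp
    then show "cmod (x f - z f) \<le> dual_norm E (\<lambda>i. x i - y i) + dual_norm E (\<lambda>i. y i - z i)"
      using upper[OF x y f] upper[OF y z f] by simp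
  qed
qed

lemma pairing_unit_vec: "pairing f (unit_vec s) = f s"
proof -
  have "pairing f (unit_vec s) = (\<Sum>\<^sub>\<infinity>t\<in>{s}. f t * unit_vec s t)"
    unfolding pairing_def by (rule infsum_cong_neutral) (auto simp: unit_vec_def)
  then show ?thesis by (simp add: unit_vec_def)
qed

lemma ell1_conv_unit_vec: "ell1_conv (unit_vec s) (unit_vec t) = unit_vec (s * t)"
proof
  fix u
  have "ell1_conv (unit_vec s) (unit_vec t) u =
      (\<Sum>\<^sub>\<infinity>p\<in>(if s * t = u then {(s, t)} else {}). case p of (p, q) \<Rightarrow> unit_vec s p * unit_vec t q)"
    unfolding ell1_conv_def
    by (rule infsum_cong_neutral) (auto simp: unit_vec_def split: if_splits)
  also have "\<dots> = unit_vec (s * t) u" by (auto simp: unit_vec_def)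
  finally show "ell1_conv (unit_vec s) (unit_vec t) u = unit_vec (s * t) u" .
qed

lemma left_act_unit_vec: "left_act (unit_vec s) f = (\<lambda>t. f (t * s))"
  by (simp add: left_act_def ell1_conv_unit_vec pairing_unit_vec)

lemma right_act_unit_vec: "right_act f (unit_vec s) = (\<lambda>t. f (s * t))"
  by (simp add: right_act_def ell1_conv_unit_vec pairing_unit_vec)

lemma topspace_gelfand_topology: "topspace (gelfand_topology E) = character_space E"
  by (auto simp: gelfand_topology_def character_space_def PiE_def)

end

theory Submission
  imports Defs "HOL-Library.Function_Algebras"
begin

text \<open>
  Let \<open>\<Lambda>\<close> be a bounded functional on \<open>\<ell>\<^sup>\<infinity>(S)\<close> annihilating \<open>E\<close>. For each bounded \<open>h\<close> the functional
  \<open>g \<mapsto> \<Lambda>(h g)\<close> on \<open>E\<close> is given by some \<open>T h \<in> \<ell>\<^sup>1(S)\<close>, and \<open>T (f h) = f \<cdot> T h\<close> for \<open>f \<in> E\<close> because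
  \<open>E\<close> is an algebra. Hence \<open>T (w h)\<close> vanishes at \<open>s\<close> when \<open>w = |g - g s|\<^sup>2\<close> with \<open>g \<in> E\<close> (move the conjugate
  factor into \<open>h\<close>), and dividing by sums of such \<open>w\<close> gives \<open>T (f h) = f \<cdot> T h\<close> for every bounded \<open>f\<close>
  that is continuous for the topology on \<open>S\<close> induced by \<open>E\<close>. As \<open>T 1 = 0\<close>, \<open>\<Lambda>\<close> kills every such \<open>f\<close>
  that vanishes at infinity, so by Hahn-Banach \<open>E\<close> is all of \<open>C\<^sub>0(S)\<close> for this topology. In particular
  \<open>E\<close> is self-adjoint and is determined by the topology of \<open>K\<close>.

  A character is pairing with some \<open>a \<in> \<ell>\<^sup>1(S)\<close>; multiplicativity says that \<open>g a - \<phi>(g) a\<close> annihilates \<open>E\<close>,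
  so \<open>\<phi>\<close> is evaluation at any point where \<open>a\<close> does not vanish. The claims about \<open>K\<close> follow because \<open>E\<close>
  is invariant under translations.
\<close>

subsection \<open>The Hahn-Banach theorem\<close>

text \<open>Scaling by reals and the subset \<open>V\<close> are parameters so that the theorem can
  be applied to the bounded functions inside the type of all complex-valued functions.\<close>

locale real_vector_subspace = vector_space scale
  for scale :: "real \<Rightarrow> 'a::ab_group_add \<Rightarrow> 'a" +
  fixes V :: "'a set"
  assumes V: "subspace V"
begin

definition sublinear :: "('a \<Rightarrow> real) \<Rightarrow> bool" where
  "sublinear p \<longleftrightarrow> (\<forall>x\<in>V. \<forall>y\<in>V. p (x + y) \<le> p x + p y) \<and> (\<forall>c\<ge>0. \<forall>x\<in>V. p (scale c x) \<le> c * p x)"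

lemma V_simps [simp, intro]:
  "0 \<in> V" "x \<in> V \<Longrightarrow> y \<in> V \<Longrightarrow> x + y \<in> V" "x \<in> V \<Longrightarrow> scale c x \<in> V" "x \<in> V \<Longrightarrow> - x \<in> V"
  using V by (auto simp: subspace_0 subspace_add subspace_scale subspace_neg)

lemma sublinear_add: "sublinear p \<Longrightarrow> x \<in> V \<Longrightarrow> y \<in> V \<Longrightarrow> p (x + y) \<le> p x + p y"
  by (simp add: sublinear_def)

lemma sublinear_zero:
  assumes "sublinear p" shows "p 0 = 0"
proof -
  have "p (scale 0 0) \<le> 0 * p 0"
    using assms V_simps(1) unfolding sublinear_def by blast
  moreover have "p (0 + 0) \<le> p 0 + p 0" using assms by (intro sublinear_add) auto
  ultimately show ?thesis by simp
qed

lemma sublinear_scale: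
  assumes p: "sublinear p" and x: "x \<in> V" and c: "c \<ge> 0" shows "p (scale c x) = c * p x"
proof (cases "c = 0")
  case False
  have le: "p (scale d y) \<le> d * p y" if "d \<ge> 0" "y \<in> V" for d y
    using p that by (simp add: sublinear_def)
  have "p (scale (inverse c) (scale c x)) \<le> inverse c * p (scale c x)" using c x by (intro le) auto
  then have "c * p x \<le> p (scale c x)" using c False by (simp add: field_simps)
  with le[OF c x] show ?thesis by simp
qed (simp add: sublinear_zero[OF p])

lemma sublinear_neg:
  assumes "sublinear p" "x \<in> V" shows "- p (- x) \<le> p x"
  using sublinear_add[OF assms(1,2), of "- x"] assms sublinear_zero[OF assms(1)] by simp

text \<open>
  The largest sublinear functional below \<open>p\<close> whose value at \<open>- z\<close> is at most \<open>- p z\<close>; a minimal sublinear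
  functional equals all of these, hence is odd and therefore linear.
\<close>

definition lowered :: "('a \<Rightarrow> real) \<Rightarrow> 'a \<Rightarrow> 'a \<Rightarrow> real" where
  "lowered p z y = (INF t\<in>{0..}. p (y + scale t z) - t * p z)"

text \<open>Subadditivity at \<open>- y + (y + scale t z)\<close> bounds every term of the infimum
  below by \<open>- p (- y)\<close>, so the infimum is finite.\<close>

lemma lowered_le:
  assumes p: "sublinear p" and z: "z \<in> V" and y: "y \<in> V" and t: "t \<ge> 0"
  shows "lowered p z y \<le> p (y + scale t z) - t * p z"
  unfolding lowered_def
proof (rule cINF_lower)
  have "- p (- y) \<le> p (y + scale t z) - t * p z" if "t \<ge> 0" for t
  proof -
    have "p (- y + (y + scale t z)) \<le> p (- y) + p (y + scale t z)" using p y z by (intro sublinear_add) auto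
    then show ?thesis using sublinear_scale[OF p z that] by simp
  qed
  then show "bdd_below ((\<lambda>t. p (y + scale t z) - t * p z) ` {0..})" by (intro bdd_belowI2) auto
qed (use t in auto)

lemma lowered_greatest:
  "(\<And>t. t \<ge> 0 \<Longrightarrow> B \<le> p (y + scale t z) - t * p z) \<Longrightarrow> B \<le> lowered p z y"
  unfolding lowered_def by (intro cINF_greatest) auto

text \<open>Subadditivity comes from adding the parameters \<open>s\<close> and \<open>t\<close>,
  homogeneity from substituting \<open>c * t\<close> for \<open>t\<close>.\<close>

lemma sublinear_lowered:
  assumes p: "sublinear p" and z: "z \<in> V"
  shows "sublinear (lowered p z)"
  unfolding sublinear_def
proof safe
  fix x y assume x: "x \<in> V" and y: "y \<in> V"
  have "lowered p z (x + y) - (p (x + scale s z) - s * p z) \<le> p (y + scale t z) - t * p z"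
    if s: "s \<ge> 0" and t: "t \<ge> 0" for s t
  proof -
    have "lowered p z (x + y) \<le> p (x + y + scale (s + t) z) - (s + t) * p z"
      using s t x y by (intro lowered_le[OF p z]) auto
    also have "x + y + scale (s + t) z = (x + scale s z) + (y + scale t z)"
      by (simp add: scale_left_distrib)
    also have "p \<dots> \<le> p (x + scale s z) + p (y + scale t z)" using x y z by (intro sublinear_add[OF p]) auto
    finally show ?thesis by (simp add: algebra_simps)
  qed
  then have "lowered p z (x + y) - (p (x + scale s z) - s * p z) \<le> lowered p z y" if "s \<ge> 0" for s
    using that by (intro lowered_greatest)
  then have "lowered p z (x + y) - lowered p z y \<le> p (x + scale s z) - s * p z" if "s \<ge> 0" for s
    using that by (simp add: algebra_simps)
  then have "lowered p z (x + y) - lowered p z y \<le> lowered p z x" by (intro lowered_greatest)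
  then show "lowered p z (x + y) \<le> lowered p z x + lowered p z y" by simp
next
  fix c :: real and x assume c: "c \<ge> 0" and x: "x \<in> V"
  show "lowered p z (scale c x) \<le> c * lowered p z x"
  proof (cases "c = 0")
    case True
    then show ?thesis using lowered_le[OF p z, of 0 0] sublinear_zero[OF p] by simp
  next
    case False
    have "lowered p z (scale c x) / c \<le> p (x + scale t z) - t * p z" if t: "t \<ge> 0" for t
    proof -
      have "lowered p z (scale c x) \<le> p (scale c x + scale (c * t) z) - c * t * p z"
        using c t x by (intro lowered_le[OF p z]) auto
      also have "scale c x + scale (c * t) z = scale c (x + scale t z)" by (simp add: scale_right_distrib)
      also have "p \<dots> = c * p (x + scale t z)" using c x z by (intro sublinear_scale[OF p]) auto
      finally show ?thesis using c False by (simp add: field_simps)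
    qed
    then have "lowered p z (scale c x) / c \<le> lowered p z x" by (rule lowered_greatest)
    then show ?thesis using c False by (simp add: field_simps)
  qed
qed

text \<open>Zorn's lemma for the sublinear functionals below \<open>q\<close>; a nonempty chain is
  bounded by its pointwise infimum.\<close>

lemma minimal_sublinear:
  assumes q: "sublinear q"
  obtains p where "sublinear p" "\<And>x. x \<in> V \<Longrightarrow> p x \<le> q x"
    "\<And>r x. sublinear r \<Longrightarrow> (\<And>y. y \<in> V \<Longrightarrow> r y \<le> p y) \<Longrightarrow> x \<in> V \<Longrightarrow> r x = p x"
proof -
  define A where "A = {p. sublinear p \<and> (\<forall>x\<in>V. p x \<le> q x) \<and> (\<forall>x. x \<notin> V \<longrightarrow> p x = 0)}"
  \<comment> \<open>Larger for \<open>R\<close> means smaller pointwise, so the maximal element from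
    Zorn's lemma is a minimal functional.\<close>
  define R :: "('a \<Rightarrow> real) \<Rightarrow> ('a \<Rightarrow> real) \<Rightarrow> bool" where "R = (\<lambda>p r. \<forall>x. r x \<le> p x)"
  define cut where "cut p x = (if x \<in> V then p x else 0)" for p :: "'a \<Rightarrow> real" and x
  have cut: "sublinear (cut p)" if "sublinear p" for p
    using that by (simp add: sublinear_def cut_def)
  have "\<exists>m\<in>A. \<forall>a\<in>A. R m a \<longrightarrow> a = m"
  proof (rule predicate_Zorn)
    show "partial_order_on A (relation_of R A)"
      by (rule partial_order_on_relation_ofI) (auto simp: R_def fun_eq_iff intro: order_trans antisym)
    fix C assume C: "C \<in> Chains (relation_of R A)"
    have chain: "R p r \<or> R r p" if "p \<in> C" "r \<in> C" for p r
      using C that by (auto simp: Chains_def relation_of_def)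
    have CA: "p \<in> A" if "p \<in> C" for p
      using C that by (auto simp: Chains_def relation_of_def)
    show "\<exists>u\<in>A. \<forall>a\<in>C. R a u"
    proof (cases "C = {}")
      case True
      have "cut q \<in> A" using cut[OF q] by (simp add: A_def cut_def)
      then show ?thesis using True by auto
    next
      case False
      define u where "u x = (if x \<in> V then INF p\<in>C. p x else 0)" for x
      have u_le: "u x \<le> p x" if "p \<in> C" "x \<in> V" for p x
        unfolding u_def using that
      proof (simp, intro cINF_lower bdd_belowI2)
        fix r assume "r \<in> C"
        then have "- r (- x) \<le> r x" "r (- x) \<le> q (- x)"
          using CA sublinear_neg that(2) by (auto simp: A_def)
        then show "- q (- x) \<le> r x" by simp
      qed
      have u_greatest: "B \<le> u x" if "\<And>p. p \<in> C \<Longrightarrow> B \<le> p x" "x \<in> V" for B x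
        using that False by (auto simp: u_def intro: cINF_greatest)
      have "sublinear u"
        unfolding sublinear_def
      proof safe
        fix x y assume x: "x \<in> V" and y: "y \<in> V"
        have "u (x + y) - p x \<le> r y" if pr: "p \<in> C" "r \<in> C" for p r
        proof -
          \<comment> \<open>One of \<open>p\<close> and \<open>r\<close> lies below the other; the
            subadditivity of this smaller one bounds \<open>u (x + y)\<close> by
            \<open>p x + r y\<close>.\<close>
          obtain w where w: "w \<in> C" "R p w" "R r w" using chain[OF pr] pr by (auto simp: R_def)
          have "u (x + y) \<le> w (x + y)" using u_le w x y by auto
          also have "\<dots> \<le> w x + w y" using CA[OF w(1)] x y by (auto simp: A_def intro: sublinear_add)
          also have "\<dots> \<le> p x + r y" using w by (intro add_mono) (auto simp: R_def)
          finally show ?thesis by simp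
        qed
        then have "u (x + y) - p x \<le> u y" if "p \<in> C" for p using u_greatest y that by blast
        then have "u (x + y) - u y \<le> p x" if "p \<in> C" for p using that by (simp add: algebra_simps)
        then have "u (x + y) - u y \<le> u x" using u_greatest x by blast
        then show "u (x + y) \<le> u x + u y" by simp
      next
        fix c :: real and x assume c: "c \<ge> 0" and x: "x \<in> V"
        have le: "u (scale c x) \<le> c * p x" if p: "p \<in> C" for p
          using u_le[OF p, of "scale c x"] sublinear_scale[of p x c] CA[OF p] c x by (simp add: A_def)
        show "u (scale c x) \<le> c * u x"
        proof (cases "c = 0")
          case True
          then show ?thesis using le False by auto
        next
          case c0: False
          have "u (scale c x) / c \<le> u x"
            using le c c0 x by (intro u_greatest) (auto simp: field_simps)
          then show ?thesis using c c0 by (simp add: field_simps)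
        qed
      qed
      moreover have "u x \<le> q x" if "x \<in> V" for x
      proof -
        obtain p where p: "p \<in> C" using False by auto
        then show ?thesis using u_le[OF p that] CA[OF p] that by (force simp: A_def)
      qed
      ultimately have "u \<in> A" by (simp add: A_def u_def)
      moreover have "R p u" if "p \<in> C" for p
        using u_le CA[OF that] that by (auto simp: R_def A_def u_def)
      ultimately show ?thesis by blast
    qed
  qed
  then obtain p where p: "p \<in> A" and min: "\<And>a. a \<in> A \<Longrightarrow> R p a \<Longrightarrow> a = p" by blast
  show ?thesis
  proof
    show "sublinear p" "\<And>x. x \<in> V \<Longrightarrow> p x \<le> q x" using p by (auto simp: A_def)
    fix r x assume r: "sublinear r" and le: "\<And>y. y \<in> V \<Longrightarrow> r y \<le> p y" and x: "x \<in> V"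
    have "cut r \<in> A" using cut[OF r] p le by (fastforce simp: A_def cut_def)
    moreover have "R p (cut r)" using p le by (auto simp: R_def cut_def A_def)
    ultimately have "cut r = p" by (rule min)
    then show "r x = p x" using x by (auto simp: cut_def)
  qed
qed

text \<open>A minimal sublinear \<open>p\<close> below \<open>lowered q z\<close> coincides with
  \<open>lowered p x\<close> for every \<open>x\<close> in \<open>V\<close>, which makes it odd and
  therefore linear. Starting from \<open>lowered q z\<close> instead of \<open>q\<close> forces
  \<open>p (- z) \<le> - q z\<close>, whence \<open>p z = q z\<close>.\<close>

theorem hahn_banach:
  assumes q: "sublinear q" and z: "z \<in> V"
  obtains L where "\<And>x y. x \<in> V \<Longrightarrow> y \<in> V \<Longrightarrow> L (x + y) = L x + L y"
    "\<And>c x. x \<in> V \<Longrightarrow> L (scale c x) = c * L x"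
    "\<And>x. x \<in> V \<Longrightarrow> L x \<le> q x" "L z = q z"
proof -
  obtain p where p: "sublinear p" and pq: "\<And>x. x \<in> V \<Longrightarrow> p x \<le> lowered q z x"
    and min: "\<And>r x. sublinear r \<Longrightarrow> (\<And>y. y \<in> V \<Longrightarrow> r y \<le> p y) \<Longrightarrow> x \<in> V \<Longrightarrow> r x = p x"
    by (rule minimal_sublinear[OF sublinear_lowered[OF q z]]) blast
  have low: "lowered r y x \<le> r x" "lowered r y (- y) \<le> - r y" if "sublinear r" "x \<in> V" "y \<in> V" for r x y
    using lowered_le[OF that(1,3,2), of 0] lowered_le[OF that(1,3) V_simps(4)[OF that(3)], of 1] that
    by (simp_all add: sublinear_zero)
  have neg: "p (- x) = - p x" if x: "x \<in> V" for x
  proof -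
    have "lowered p x (- x) = p (- x)"
      using low[OF p _ x] x by (intro min sublinear_lowered[OF p x]) auto
    then show ?thesis using low(2)[OF p x x] sublinear_neg[OF p x] by simp
  qed
  show ?thesis
  proof
    fix x y assume x: "x \<in> V" and y: "y \<in> V"
    have "p (x + y + - y) \<le> p (x + y) + p (- y)" using x y by (intro sublinear_add[OF p]) auto
    then show "p (x + y) = p x + p y" using sublinear_add[OF p x y] neg[OF y] by simp
  next
    fix c x assume x: "x \<in> V"
    show "p (scale c x) = c * p x"
    proof (cases "c \<ge> 0")
      case False
      then have "p (scale (- c) x) = - c * p x" using x by (intro sublinear_scale[OF p]) auto
      then show ?thesis using neg[of "scale c x"] x by simp
    qed (use sublinear_scale[OF p x] in auto)
  next
    fix x assume x: "x \<in> V"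
    show "p x \<le> q x" using pq[OF x] low(1)[OF q x z] by simp
  next
    show "p z = q z"
      using pq[OF z] low(1)[OF q z z] pq[of "- z"] low(2)[OF q z z] neg[OF z] z by auto
  qed
qed

end

section \<open>Bounded functions and separation from a subspace\<close>

lemma linfI: "(\<And>s. cmod (f s) \<le> B) \<Longrightarrow> f \<in> linf"
  by (auto simp: linf_def bounded_iff)

lemma linf_add [intro]: "f \<in> linf \<Longrightarrow> g \<in> linf \<Longrightarrow> (\<lambda>s. f s + g s) \<in> linf"
  unfolding linf_def by (auto intro: bounded_plus_comp)

lemma linf_mult [intro]:
  assumes "f \<in> linf" "g \<in> linf" shows "(\<lambda>s. f s * g s) \<in> linf"
proof (rule linfI)
  show "cmod (f s * g s) \<le> sup_norm f * sup_norm g" for s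
    using assms by (auto simp: norm_mult intro!: mult_mono norm_le_sup_norm sup_norm_nonneg)
qed

lemma linf_const [intro]: "(\<lambda>s. c) \<in> linf"
  by (rule linfI) auto

lemma linf_scale [intro]: "f \<in> linf \<Longrightarrow> (\<lambda>s. c * f s) \<in> linf"
  by (rule linf_mult[OF linf_const])

lemma linf_cnj [intro]: "f \<in> linf \<Longrightarrow> (\<lambda>s. cnj (f s)) \<in> linf"
  by (rule linfI[of _ "sup_norm f"]) (simp add: norm_le_sup_norm)

lemma linf_sum [intro]: "(\<And>i. i \<in> I \<Longrightarrow> F i \<in> linf) \<Longrightarrow> (\<lambda>s. \<Sum>i\<in>I. F i s) \<in> linf"
  by (induction I rule: infinite_finite_induct) auto

lemma sup_norm_add:
  assumes "f \<in> linf" "g \<in> linf" shows "sup_norm (\<lambda>s. f s + g s) \<le> sup_norm f + sup_norm g"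
proof (rule sup_norm_le)
  show "cmod (f s + g s) \<le> sup_norm f + sup_norm g" for s
    using assms by (intro order_trans[OF norm_triangle_ineq] add_mono norm_le_sup_norm)
qed

lemma sup_norm_scale_le:
  assumes "f \<in> linf" shows "sup_norm (\<lambda>s. c * f s) \<le> cmod c * sup_norm f"
  using assms by (intro sup_norm_le) (auto simp: norm_mult intro: mult_left_mono norm_le_sup_norm)

interpretation linf_real: real_vector_subspace "\<lambda>c (x :: 's \<Rightarrow> complex) i. complex_of_real c * x i" linf
proof
  show "module.subspace (\<lambda>c (x :: 's \<Rightarrow> complex) i. complex_of_real c * x i) linf"
    by (subst module.subspace_def) (unfold_locales; auto simp: plus_fun_def zero_fun_def algebra_simps)+
qed (auto simp: algebra_simps)

text \<open>The distance \<open>q\<close> to \<open>E\<close> is sublinear. A real functional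
  dominated by \<open>q\<close> with value \<open>q z\<close> at \<open>z\<close> vanishes on
  \<open>E\<close> and is at least \<open>d\<close> at \<open>z\<close>; complexifying it gives
  \<open>\<Lambda>\<close>.\<close>

lemma separating_functional:
  assumes EV: "E \<subseteq> linf" and E: "complex_subspace E" and z: "z \<in> linf" and d: "d > 0"
    and dist: "\<And>e. e \<in> E \<Longrightarrow> d \<le> sup_norm (\<lambda>s. z s - e s)"
  obtains \<Lambda> where "complex_linear_on linf \<Lambda>" "\<And>x. x \<in> linf \<Longrightarrow> cmod (\<Lambda> x) \<le> 2 * sup_norm x"
    "\<And>e. e \<in> E \<Longrightarrow> \<Lambda> e = 0" "\<Lambda> z \<noteq> 0"
proof -
  define q where "q x = (INF e\<in>E. sup_norm (\<lambda>s. x s - e s))" for x :: "'a \<Rightarrow> complex"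
  have E0: "(\<lambda>s. 0) \<in> E" and Eadd: "\<And>x y. x \<in> E \<Longrightarrow> y \<in> E \<Longrightarrow> (\<lambda>s. x s + y s) \<in> E"
    and Escale: "\<And>c x. x \<in> E \<Longrightarrow> (\<lambda>s. c * x s) \<in> E"
    using E by (auto simp: complex_subspace_def)
  have q_le: "q x \<le> sup_norm (\<lambda>s. x s - e s)" if "x \<in> linf" "e \<in> E" for x e
    unfolding q_def
  proof (intro cINF_lower bdd_belowI2)
    show "0 \<le> sup_norm (\<lambda>s. x s - e s)" if "e \<in> E" for e
      using that \<open>x \<in> linf\<close> EV by (intro sup_norm_nonneg linf_diff) auto
  qed fact
  have q_greatest: "B \<le> q x" if "\<And>e. e \<in> E \<Longrightarrow> B \<le> sup_norm (\<lambda>s. x s - e s)" for B x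
    unfolding q_def using E0 that by (intro cINF_greatest) auto
  have sub: "linf_real.sublinear q"
    unfolding linf_real.sublinear_def
  proof safe
    fix x y :: "'a \<Rightarrow> complex" assume x: "x \<in> linf" and y: "y \<in> linf"
    have "q (x + y) - sup_norm (\<lambda>s. x s - e s) \<le> sup_norm (\<lambda>s. y s - e' s)" if "e \<in> E" "e' \<in> E" for e e'
    proof -
      have "q (x + y) \<le> sup_norm (\<lambda>s. (x + y) s - (e s + e' s))"
        using x y that by (intro q_le Eadd) (auto simp: plus_fun_def)
      also have "\<dots> = sup_norm (\<lambda>s. (x s - e s) + (y s - e' s))" by (simp add: algebra_simps)
      also have "\<dots> \<le> sup_norm (\<lambda>s. x s - e s) + sup_norm (\<lambda>s. y s - e' s)"
        using x y that EV by (intro sup_norm_add linf_diff) auto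
      finally show ?thesis by simp
    qed
    then have "q (x + y) - sup_norm (\<lambda>s. x s - e s) \<le> q y" if "e \<in> E" for e
      using that by (intro q_greatest)
    then have "q (x + y) - q y \<le> sup_norm (\<lambda>s. x s - e s)" if "e \<in> E" for e
      using that by (simp add: algebra_simps)
    then have "q (x + y) - q y \<le> q x" by (rule q_greatest)
    then show "q (x + y) \<le> q x + q y" by simp
  next
    fix c :: real and x :: "'a \<Rightarrow> complex" assume c: "c \<ge> 0" and x: "x \<in> linf"
    have le: "q (\<lambda>s. of_real c * x s) \<le> c * sup_norm (\<lambda>s. x s - e s)" if e: "e \<in> E" for e
    proof -
      have "q (\<lambda>s. of_real c * x s) \<le> sup_norm (\<lambda>s. of_real c * x s - of_real c * e s)"
        using x e by (intro q_le Escale) auto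
      also have "\<dots> = sup_norm (\<lambda>s. of_real c * (x s - e s))" by (simp add: algebra_simps)
      also have "\<dots> \<le> c * sup_norm (\<lambda>s. x s - e s)"
        using sup_norm_scale_le[of "\<lambda>s. x s - e s" "of_real c"] linf_diff x e EV c by auto
      finally show ?thesis .
    qed
    show "q (\<lambda>s. of_real c * x s) \<le> c * q x"
    proof (cases "c = 0")
      case True
      then show ?thesis using le[OF E0] by simp
    next
      case False
      have "q (\<lambda>s. of_real c * x s) / c \<le> q x"
        using le c False by (intro q_greatest) (auto simp: field_simps)
      then show ?thesis using c False by (simp add: field_simps)
    qed
  qed
  obtain L where L: "\<And>x y. x \<in> linf \<Longrightarrow> y \<in> linf \<Longrightarrow> L (x + y) = L x + L y"
    "\<And>c x. x \<in> linf \<Longrightarrow> L (\<lambda>s. complex_of_real c * x s) = c * L x"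
    "\<And>x. x \<in> linf \<Longrightarrow> L x \<le> q x" "L z = q z"
    using linf_real.hahn_banach[OF sub z] by blast
  have Ladd: "L (\<lambda>s. x s + y s) = L x + L y" if "x \<in> linf" "y \<in> linf" for x y
    using L(1)[OF that] by (simp add: plus_fun_def)
  have Lneg: "L (\<lambda>s. - x s) = - L x" if "x \<in> linf" for x using L(2)[OF that, of "-1"] by simp
  have Lnorm: "\<bar>L x\<bar> \<le> sup_norm x" if x: "x \<in> linf" for x
  proof -
    have le: "L y \<le> sup_norm y" if "y \<in> linf" for y
      using L(3)[OF that] q_le[OF that E0] by simp
    have "sup_norm (\<lambda>s. - x s) = sup_norm x" by (simp add: sup_norm_def)
    then show ?thesis using le[OF x] le[of "\<lambda>s. - x s"] Lneg[OF x] linf_scale[OF x, of "-1"] by simp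
  qed
  have LE: "L e = 0" if e: "e \<in> E" for e
  proof -
    have le: "L e \<le> 0" if e: "e \<in> E" for e
      using L(3)[of e] q_le[of e e] e EV by (auto simp: sup_norm_def)
    show ?thesis using le[OF e] le[OF Escale[OF e, of "-1"]] Lneg[of e] e EV by auto
  qed
  \<comment> \<open>The complex functional with real part \<open>L\<close>; complex linearity
    dictates the imaginary part.\<close>
  define \<Lambda> where "\<Lambda> x = Complex (L x) (- L (\<lambda>s. \<i> * x s))" for x
  have \<Lambda>add: "\<Lambda> (\<lambda>s. x s + y s) = \<Lambda> x + \<Lambda> y" if "x \<in> linf" "y \<in> linf" for x y
    using Ladd[OF linf_scale[OF that(1), of \<i>] linf_scale[OF that(2), of \<i>]] Ladd[OF that]
    by (auto simp: \<Lambda>_def complex_eq_iff distrib_left)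
  have \<Lambda>real: "\<Lambda> (\<lambda>s. of_real c * x s) = of_real c * \<Lambda> x" if "x \<in> linf" for c x
    using L(2)[OF that, of c] L(2)[OF linf_scale[OF that, of \<i>], of c]
    by (auto simp: \<Lambda>_def complex_eq_iff mult.left_commute)
  have \<Lambda>i: "\<Lambda> (\<lambda>s. \<i> * x s) = \<i> * \<Lambda> x" if "x \<in> linf" for x
    using Lneg[OF that] by (auto simp: \<Lambda>_def complex_eq_iff mult.assoc[symmetric])
  have \<Lambda>scale: "\<Lambda> (\<lambda>s. c * x s) = c * \<Lambda> x" if x: "x \<in> linf" for c x
  proof -
    have c: "c * y = of_real (Re c) * y + \<i> * (of_real (Im c) * y)" for y
      by (simp add: complex_eq_iff)
    have "\<Lambda> (\<lambda>s. c * x s) = \<Lambda> (\<lambda>s. of_real (Re c) * x s + \<i> * (of_real (Im c) * x s))"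
      unfolding c[symmetric] ..
    also have "\<dots> = of_real (Re c) * \<Lambda> x + \<i> * (of_real (Im c) * \<Lambda> x)"
      using x by (simp add: \<Lambda>add \<Lambda>i \<Lambda>real linf_scale)
    also have "\<dots> = c * \<Lambda> x" by (rule c[symmetric])
    finally show ?thesis .
  qed
  show ?thesis
  proof
    show "complex_linear_on linf \<Lambda>" using \<Lambda>add \<Lambda>scale by (auto simp: complex_linear_on_def)
    \<comment> \<open>The constant 2 comes from bounding the modulus by the sum of the absolute
      values of the real and imaginary parts.\<close>
    show "cmod (\<Lambda> x) \<le> 2 * sup_norm x" if x: "x \<in> linf" for x
    proof -
      have "sup_norm (\<lambda>s. \<i> * x s) = sup_norm x" by (simp add: sup_norm_def norm_mult)
      then have "\<bar>L x\<bar> \<le> sup_norm x" "\<bar>L (\<lambda>s. \<i> * x s)\<bar> \<le> sup_norm x"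
        using Lnorm[OF x] Lnorm[OF linf_scale[OF x, of \<i>]] by auto
      then show ?thesis using cmod_le[of "\<Lambda> x"] by (simp add: \<Lambda>_def)
    qed
    show "\<Lambda> e = 0" if "e \<in> E" for e using LE[OF that] LE[OF Escale[OF that]] by (simp add: \<Lambda>_def complex_eq_iff)
    show "\<Lambda> z \<noteq> 0" using q_greatest[of d z] dist d L(4) by (auto simp: \<Lambda>_def complex_eq_iff)
  qed
qed

section \<open>Summable functions and the pairing\<close>

lemma ell1_scale: "a \<in> ell1 \<Longrightarrow> (\<lambda>s. c * a s) \<in> ell1"
  by (auto simp: ell1_def norm_mult intro: summable_on_cmult_right)

lemma ell1_add:
  assumes "a \<in> ell1" "b \<in> ell1" shows "(\<lambda>s. a s + b s) \<in> ell1"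
proof -
  have "(\<lambda>s. cmod (a s + b s)) summable_on UNIV"
    by (rule summable_on_comparison_test[of "\<lambda>s. cmod (a s) + cmod (b s)"])
      (use assms in \<open>auto simp: ell1_def norm_triangle_ineq intro: summable_on_add\<close>)
  then show ?thesis by (simp add: ell1_def)
qed

lemma ell1_mult:
  assumes f: "f \<in> linf" and a: "a \<in> ell1" shows "(\<lambda>s. f s * a s) \<in> ell1"
proof -
  have "(\<lambda>s. cmod (f s * a s)) summable_on UNIV"
    by (rule summable_on_comparison_test[of "\<lambda>s. sup_norm f * cmod (a s)"])
      (use assms in \<open>auto simp: ell1_def norm_mult intro: summable_on_cmult_right mult_right_mono norm_le_sup_norm\<close>)
  then show ?thesis by (simp add: ell1_def)
qed

lemma ell1_summable: "a \<in> ell1 \<Longrightarrow> a summable_on UNIV"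
  using abs_summable_summable by (auto simp: ell1_def)

lemma pairing_add:
  assumes "f \<in> linf" "a \<in> ell1" "b \<in> ell1"
  shows "pairing f (\<lambda>s. a s + b s) = pairing f a + pairing f b"
  unfolding pairing_def distrib_left
  by (intro infsum_add ell1_summable ell1_mult assms)

lemma pairing_scale: "pairing f (\<lambda>s. c * a s) = c * pairing f a"
  unfolding pairing_def mult.left_commute[of _ c] by (rule infsum_cmult_right')

lemma pairing_zero: "pairing f (\<lambda>s. 0) = 0"
  by (simp add: pairing_def)

lemma pairing_mult: "pairing (\<lambda>s. f s * g s) a = pairing g (\<lambda>s. f s * a s)"
  by (simp add: pairing_def mult_ac)

lemma unit_vec_ell1: "unit_vec s \<in> ell1"
proof -
  have "(\<lambda>t. cmod (unit_vec s t)) summable_on UNIV \<longleftrightarrow> (\<lambda>t. cmod (unit_vec s t)) summable_on {s}"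
    by (rule summable_on_cong_neutral) (auto simp: unit_vec_def)
  then show ?thesis by (simp add: ell1_def)
qed

lemma zero_ell1: "(\<lambda>s. 0) \<in> ell1"
  by (simp add: ell1_def)

lemma cmod_le_ell1_norm:
  assumes "a \<in> ell1" shows "cmod (a s) \<le> ell1_norm a"
  using finite_sum_le_infsum[of "\<lambda>s. cmod (a s)" UNIV "{s}"] assms by (simp add: ell1_def ell1_norm_def)

subsection \<open>Functionals annihilating a Hopf algebra predual\<close>

locale hopf_predual =
  fixes E :: "('s::semigroup_mult \<Rightarrow> complex) set"
  assumes hopf: "hopf_algebra_predual E"
begin

lemma E_linf: "E \<subseteq> linf"
  and E_subspace: "complex_subspace E"
  and E_closed: "closedin (norm_topology linf sup_norm) E"
  and E_homeo: "homeomorphic_map (norm_topology ell1 ell1_norm)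
    (norm_topology (dual_space E) (dual_norm E)) (canonical_map E)"
  and E_mult: "f \<in> E \<Longrightarrow> g \<in> E \<Longrightarrow> (\<lambda>s. f s * g s) \<in> E"
  using hopf by (auto simp: hopf_algebra_predual_def predual_def sub_bimodule_def)

lemma E_zero: "(\<lambda>s. 0) \<in> E"
  and E_add: "f \<in> E \<Longrightarrow> g \<in> E \<Longrightarrow> (\<lambda>s. f s + g s) \<in> E"
  and E_scale: "f \<in> E \<Longrightarrow> (\<lambda>s. c * f s) \<in> E"
  using E_subspace by (auto simp: complex_subspace_def)

lemma E_bounded: "f \<in> E \<Longrightarrow> f \<in> linf"
  using E_linf by auto

text \<open>Translations are the module actions of unit vectors, and \<open>E\<close> is a
  sub-bimodule.\<close>

lemma E_right_translate: "f \<in> E \<Longrightarrow> (\<lambda>t. f (t * s)) \<in> E"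
  and E_left_translate: "f \<in> E \<Longrightarrow> (\<lambda>t. f (s * t)) \<in> E"
  using hopf unit_vec_ell1[of s] left_act_unit_vec[of s f] right_act_unit_vec[of f s]
  unfolding hopf_algebra_predual_def predual_def sub_bimodule_def by metis+

lemma canonical_bij: "bij_betw (canonical_map E) ell1 (dual_space E)"
proof -
  interpret l1: Metric_space "ell1 :: ('s \<Rightarrow> complex) set" "norm_dist ell1 ell1_norm"
    by (rule Metric_space_ell1)
  interpret dual: Metric_space "dual_space E" "norm_dist (dual_space E) (dual_norm E)"
    by (rule Metric_space_dual_space[OF E_linf E_subspace])
  show ?thesis
    using homeomorphic_imp_injective_map[OF E_homeo] homeomorphic_imp_surjective_map[OF E_homeo]
    by (simp add: norm_topology_def bij_betw_def)
qed

text \<open>This is the injectivity of the canonical map.\<close>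

lemma ell1_eqI:
  assumes "a \<in> ell1" "b \<in> ell1" "\<And>f. f \<in> E \<Longrightarrow> pairing f a = pairing f b"
  shows "a = b"
proof -
  have "canonical_map E a = canonical_map E b" using assms(3) by (auto simp: canonical_map_def)
  then show ?thesis using canonical_bij assms by (auto simp: bij_betw_def inj_on_def)
qed

lemma dual_representer:
  assumes "\<phi> \<in> dual_space E"
  obtains a where "a \<in> ell1" "\<And>f. f \<in> E \<Longrightarrow> \<phi> f = pairing f a"
proof -
  obtain a where "a \<in> ell1" "\<phi> = canonical_map E a"
    using canonical_bij assms unfolding bij_betw_def by blast
  then show ?thesis using that by (auto simp: canonical_map_def)
qed

text \<open>The inverse of the canonical map is continuous at 0: the image of the unit ball of
  \<open>ell1\<close> contains a ball of some radius \<open>r\<close>. Only the resulting bound on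
  single coordinates is recorded.\<close>

lemma ell1_bound:
  obtains K where "K > 0"
    "\<And>a B s. a \<in> ell1 \<Longrightarrow> B > 0 \<Longrightarrow> (\<And>f. f \<in> E \<Longrightarrow> cmod (pairing f a) \<le> B * sup_norm f) \<Longrightarrow>
       cmod (a s) \<le> K * B"
proof -
  interpret l1: Metric_space "ell1 :: ('s \<Rightarrow> complex) set" "norm_dist ell1 ell1_norm"
    by (rule Metric_space_ell1)
  interpret dual: Metric_space "dual_space E" "norm_dist (dual_space E) (dual_norm E)"
    by (rule Metric_space_dual_space[OF E_linf E_subspace])
  let ?c = "canonical_map E"
  let ?U = "?c ` l1.mball (\<lambda>s. 0) 1"
  have dual: "?c a \<in> dual_space E" if "a \<in> ell1" for a
    using canonical_bij that by (auto simp: bij_betw_def)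
  have "openin dual.mtopology ?U"
    using homeomorphic_imp_open_map[OF E_homeo] l1.openin_mball
    by (auto simp: open_map_def norm_topology_def)
  moreover have "?c (\<lambda>s. 0) \<in> ?U" by (auto simp: zero_ell1)
  ultimately obtain r where r: "r > 0" "dual.mball (?c (\<lambda>s. 0)) r \<subseteq> ?U"
    unfolding dual.openin_mtopology by blast
  show ?thesis
  proof
    show "2 / r > 0" using r by simp
    fix a B s
    assume a: "a \<in> ell1" and B: "B > 0" and le: "\<And>f. f \<in> E \<Longrightarrow> cmod (pairing f a) \<le> B * sup_norm f"
    \<comment> \<open>This multiple of \<open>a\<close> has an image of dual norm at most
      \<open>r / 2\<close>, strictly inside the ball of radius \<open>r\<close>; injectivity then
      puts \<open>b\<close> itself in the unit ball.\<close>
    define b where "b = (\<lambda>s. of_real (r / (2 * B)) * a s)"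
    have b: "b \<in> ell1" unfolding b_def by (rule ell1_scale[OF a])
    have "dual_norm E (\<lambda>f. ?c (\<lambda>s. 0) f - ?c b f) \<le> r / 2"
      unfolding dual_norm_def
    proof (rule cSUP_least)
      show "{f \<in> E. sup_norm f \<le> 1} \<noteq> {}" using E_zero by (auto simp: sup_norm_def)
      fix f assume f: "f \<in> {f \<in> E. sup_norm f \<le> 1}"
      have "cmod (pairing f b) = r / (2 * B) * cmod (pairing f a)"
        using r B unfolding b_def pairing_scale by (simp add: norm_mult norm_divide)
      also have "\<dots> \<le> r / (2 * B) * (B * 1)"
        using r B f le[of f] by (intro mult_left_mono order_trans[OF le]) auto
      finally show "cmod (?c (\<lambda>s. 0) f - ?c b f) \<le> r / 2"
        using f B by (simp add: canonical_map_def pairing_zero)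
    qed
    then have "?c b \<in> ?U" using r(1) dual[OF zero_ell1] dual[OF b]
      by (intro subsetD[OF r(2)]) (simp add: norm_dist_def)
    then obtain b' where b': "b' \<in> l1.mball (\<lambda>s. 0) 1" "?c b = ?c b'" by blast
    then have "b = b'"
      using bij_betw_imp_inj_on[OF canonical_bij] b by (auto dest: inj_onD)
    then have "b \<in> l1.mball (\<lambda>s. 0) 1" using b'(1) by simp
    then have "ell1_norm b < 1"
      by (auto simp: norm_dist_def zero_ell1 ell1_norm_def)
    then have "cmod (b s) < 1" using cmod_le_ell1_norm[OF b, of s] by simp
    then have "r / (2 * B) * cmod (a s) < 1"
      using r B by (simp add: b_def norm_mult norm_divide)
    then show "cmod (a s) \<le> 2 / r * B" using r B by (simp add: field_simps)
  qed
qed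

end

section \<open>Representing elements of an annihilating functional\<close>

locale annihilating_functional = hopf_predual E
  for E :: "('s::semigroup_mult \<Rightarrow> complex) set" +
  fixes \<Lambda> :: "('s \<Rightarrow> complex) \<Rightarrow> complex"
  assumes \<Lambda>_linear: "complex_linear_on linf \<Lambda>"
    and \<Lambda>_bound: "x \<in> linf \<Longrightarrow> cmod (\<Lambda> x) \<le> 2 * sup_norm x"
    and \<Lambda>_E: "e \<in> E \<Longrightarrow> \<Lambda> e = 0"
begin

lemma \<Lambda>_add: "x \<in> linf \<Longrightarrow> y \<in> linf \<Longrightarrow> \<Lambda> (\<lambda>s. x s + y s) = \<Lambda> x + \<Lambda> y"
  and \<Lambda>_scale: "x \<in> linf \<Longrightarrow> \<Lambda> (\<lambda>s. c * x s) = c * \<Lambda> x"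
  using \<Lambda>_linear by (auto simp: complex_linear_on_def)

text \<open>The element called \<open>T h\<close> in the introductory text.\<close>

definition representer :: "('s \<Rightarrow> complex) \<Rightarrow> 's \<Rightarrow> complex" where
  "representer h = (SOME a. a \<in> ell1 \<and> (\<forall>g\<in>E. \<Lambda> (\<lambda>s. h s * g s) = pairing g a))"

lemma representer_ex:
  assumes h: "h \<in> linf"
  shows "\<exists>a. a \<in> ell1 \<and> (\<forall>g\<in>E. \<Lambda> (\<lambda>s. h s * g s) = pairing g a)"
proof -
  define \<phi> where "\<phi> = (\<lambda>g\<in>E. \<Lambda> (\<lambda>s. h s * g s))"
  have "complex_linear_on E \<phi>"
    by (auto simp: complex_linear_on_def \<phi>_def distrib_left mult.left_commute[of "h _"]
        E_add E_scale \<Lambda>_add \<Lambda>_scale linf_mult[OF h] E_bounded)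
  moreover have "cmod (\<phi> f) \<le> 2 * sup_norm h * sup_norm f" if f: "f \<in> E" for f
  proof -
    have "sup_norm (\<lambda>s. h s * f s) \<le> sup_norm h * sup_norm f"
      using h E_bounded[OF f]
      by (intro sup_norm_le) (auto simp: norm_mult intro!: mult_mono norm_le_sup_norm sup_norm_nonneg)
    then show ?thesis using \<Lambda>_bound[OF linf_mult[OF h E_bounded[OF f]]] f by (simp add: \<phi>_def)
  qed
  ultimately have "\<phi> \<in> dual_space E" by (auto simp: dual_space_def \<phi>_def)
  then show ?thesis using dual_representer[of \<phi>] by (metis \<phi>_def restrict_apply')
qed

lemma representer_ell1: "h \<in> linf \<Longrightarrow> representer h \<in> ell1"
  and \<Lambda>_mult: "h \<in> linf \<Longrightarrow> g \<in> E \<Longrightarrow> \<Lambda> (\<lambda>s. h s * g s) = pairing g (representer h)"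
  using someI_ex[OF representer_ex, of h] by (auto simp: representer_def)

lemma representer_eqI:
  assumes "h \<in> linf" "a \<in> ell1" "\<And>g. g \<in> E \<Longrightarrow> \<Lambda> (\<lambda>s. h s * g s) = pairing g a"
  shows "representer h = a"
  using assms by (intro ell1_eqI) (auto simp: representer_ell1 \<Lambda>_mult[symmetric])

lemma representer_add:
  assumes "h \<in> linf" "k \<in> linf" shows "representer (\<lambda>s. h s + k s) = (\<lambda>s. representer h s + representer k s)"
proof (rule representer_eqI)
  fix g assume g: "g \<in> E"
  show "\<Lambda> (\<lambda>s. (h s + k s) * g s) = pairing g (\<lambda>s. representer h s + representer k s)"
    unfolding distrib_right using g assms E_bounded[OF g]
    by (simp add: \<Lambda>_add linf_mult \<Lambda>_mult pairing_add representer_ell1)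
qed (use assms in \<open>auto simp: ell1_add representer_ell1\<close>)

lemma representer_scale:
  assumes "h \<in> linf" shows "representer (\<lambda>s. c * h s) = (\<lambda>s. c * representer h s)"
proof (rule representer_eqI)
  fix g assume g: "g \<in> E"
  show "\<Lambda> (\<lambda>s. c * h s * g s) = pairing g (\<lambda>s. c * representer h s)"
    unfolding mult.assoc using g assms E_bounded[OF g]
    by (simp add: \<Lambda>_scale linf_mult \<Lambda>_mult pairing_scale)
qed (use assms in \<open>auto simp: ell1_scale representer_ell1\<close>)

text \<open>As \<open>E\<close> is an algebra, \<open>f * g\<close> can be tested in place of
  \<open>g\<close>, and the pairing lets \<open>f\<close> pass to the representing element.\<close>

lemma representer_mult:
  assumes "h \<in> linf" "f \<in> E" shows "representer (\<lambda>s. f s * h s) = (\<lambda>s. f s * representer h s)"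
proof (rule representer_eqI)
  fix g assume g: "g \<in> E"
  have "\<Lambda> (\<lambda>s. h s * (f s * g s)) = pairing (\<lambda>s. f s * g s) (representer h)"
    using g assms by (intro \<Lambda>_mult E_mult) auto
  then show "\<Lambda> (\<lambda>s. f s * h s * g s) = pairing g (\<lambda>s. f s * representer h s)"
    by (simp add: pairing_mult mult_ac)
qed (use assms E_bounded in \<open>auto simp: ell1_mult representer_ell1\<close>)

lemma representer_one: "representer (\<lambda>s. 1) = (\<lambda>s. 0)"
  by (rule representer_eqI) (auto simp: \<Lambda>_E pairing_zero zero_ell1)

lemma representer_sum:
  assumes "\<And>i. i \<in> I \<Longrightarrow> F i \<in> linf" shows "representer (\<lambda>s. \<Sum>i\<in>I. F i s) = (\<lambda>s. \<Sum>i\<in>I. representer (F i) s)"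
  using assms
proof (induction I rule: infinite_finite_induct)
  case (insert i I)
  then show ?case by (simp add: representer_add linf_sum)
qed (use representer_scale[OF linf_const, of 0 0] in auto)

lemma \<Lambda>_sum:
  assumes "\<And>i. i \<in> I \<Longrightarrow> F i \<in> linf" shows "\<Lambda> (\<lambda>s. \<Sum>i\<in>I. F i s) = (\<Sum>i\<in>I. \<Lambda> (F i))"
  using assms
proof (induction I rule: infinite_finite_induct)
  case (insert i I)
  then show ?case by (simp add: \<Lambda>_add linf_sum)
qed (use \<Lambda>_E[OF E_zero] in auto)

text \<open>The functional represented by \<open>representer h\<close> has norm at most
  \<open>2 * \<epsilon>\<close>, so \<open>ell1_bound\<close> applies. This makes each coordinate of
  the representer small when \<open>h\<close> is uniformly small.\<close>

lemma representer_bound: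
  obtains K where "K > 0"
    "\<And>(h :: 's \<Rightarrow> complex) \<epsilon> s. \<epsilon> > 0 \<Longrightarrow> (\<And>t. cmod (h t) \<le> \<epsilon>) \<Longrightarrow> cmod (representer h s) \<le> K * \<epsilon>"
proof -
  obtain K where K: "K > 0"
    "\<And>a B s. a \<in> ell1 \<Longrightarrow> B > 0 \<Longrightarrow> (\<And>f. f \<in> E \<Longrightarrow> cmod (pairing f a) \<le> B * sup_norm f) \<Longrightarrow>
       cmod (a s) \<le> K * B"
    using ell1_bound by blast
  show ?thesis
  proof
    show "2 * K > 0" using K by simp
    fix h :: "'s \<Rightarrow> complex" and \<epsilon> :: real and s assume \<epsilon>: "\<epsilon> > 0" and le: "\<And>t. cmod (h t) \<le> \<epsilon>"
    have h: "h \<in> linf" using le by (rule linfI)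
    have "cmod (representer h s) \<le> K * (2 * \<epsilon>)"
    proof (rule K(2))
      fix f assume f: "f \<in> E"
      have "sup_norm (\<lambda>s. h s * f s) \<le> \<epsilon> * sup_norm f"
        using le E_bounded[OF f] \<epsilon>
        by (intro sup_norm_le) (auto simp: norm_mult intro!: mult_mono norm_le_sup_norm)
      then show "cmod (pairing f (representer h)) \<le> 2 * \<epsilon> * sup_norm f"
        using \<Lambda>_bound[OF linf_mult[OF h E_bounded[OF f]]] f by (simp add: \<Lambda>_mult[OF h f])
    qed (use \<epsilon> representer_ell1[OF h] in auto)
    then show "cmod (representer h s) \<le> 2 * K * \<epsilon>" by simp
  qed
qed

end

subsection \<open>A Hopf algebra predual is a space of functions vanishing at infinity\<close>

text \<open>
  Continuity and vanishing at infinity for the topology on \<open>S\<close> induced by \<open>E\<close>. As \<open>E\<close> is closed under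
  scaling, the thresholds on the members of \<open>G\<close> can be normalised to \<open>1\<close>.
\<close>

definition weakly_continuous :: "('s \<Rightarrow> complex) set \<Rightarrow> ('s \<Rightarrow> complex) \<Rightarrow> bool" where
  "weakly_continuous E f \<longleftrightarrow> (\<forall>s. \<forall>\<epsilon>>0. \<exists>G. finite G \<and> G \<subseteq> E \<and>
     (\<forall>t. (\<forall>g\<in>G. cmod (g t - g s) < 1) \<longrightarrow> cmod (f t - f s) < \<epsilon>))"

definition vanishing_at_infinity :: "('s \<Rightarrow> complex) set \<Rightarrow> ('s \<Rightarrow> complex) \<Rightarrow> bool" where
  "vanishing_at_infinity E f \<longleftrightarrow> (\<forall>\<epsilon>>0. \<exists>G. finite G \<and> G \<subseteq> E \<and>
     (\<forall>t. \<epsilon> \<le> cmod (f t) \<longrightarrow> (\<exists>g\<in>G. 1 \<le> cmod (g t))))"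

section \<open>Multipliers\<close>

context annihilating_functional
begin

text \<open>These are the functions whose multiplication operator commutes with
  \<open>representer\<close>. They form an algebra, and \<open>representer_mult\<close> puts
  \<open>E\<close> inside it.\<close>

definition multiplier :: "('s \<Rightarrow> complex) \<Rightarrow> bool" where
  "multiplier f \<longleftrightarrow> f \<in> linf \<and> (\<forall>h\<in>linf. representer (\<lambda>s. f s * h s) = (\<lambda>s. f s * representer h s))"

lemma multiplier_linf: "multiplier f \<Longrightarrow> f \<in> linf"
  by (simp add: multiplier_def)

lemma multiplier_const: "multiplier (\<lambda>s. c)"
  by (auto simp: multiplier_def representer_scale)

lemma multiplier_add:
  assumes "multiplier f" "multiplier g" shows "multiplier (\<lambda>s. f s + g s)"
  using assms by (auto simp: multiplier_def distrib_right representer_add linf_mult)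

lemma multiplier_mult:
  assumes "multiplier f" "multiplier g" shows "multiplier (\<lambda>s. f s * g s)"
  using assms by (auto simp: multiplier_def mult.assoc linf_mult)

lemma multiplier_sum:
  assumes "\<And>i. i \<in> I \<Longrightarrow> multiplier (F i)" shows "multiplier (\<lambda>s. \<Sum>i\<in>I. F i s)"
  using assms by (induction I rule: infinite_finite_induct) (auto intro: multiplier_const multiplier_add)

lemma multiplier_power: "multiplier f \<Longrightarrow> multiplier (\<lambda>s. f s ^ n)"
  by (induction n) (auto intro: multiplier_const multiplier_mult)

text \<open>Take \<open>h = 1\<close> in the definition and use that \<open>representer\<close>
  vanishes at the constant 1.\<close>

lemma representer_multiplier_zero:
  assumes "multiplier f" shows "representer f = (\<lambda>s. 0)"
proof -
  have "\<forall>h\<in>linf. representer (\<lambda>s. f s * h s) = (\<lambda>s. f s * representer h s)" using assms by (simp add: multiplier_def)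
  from bspec[OF this linf_const[of 1]] show ?thesis by (simp add: representer_one)
qed

lemma multiplierI:
  assumes f: "f \<in> linf" and "\<And>h s. h \<in> linf \<Longrightarrow> representer (\<lambda>t. (f t - f s) * h t) s = 0"
  shows "multiplier f"
  unfolding multiplier_def
proof (intro conjI ballI ext f)
  fix h :: "'s \<Rightarrow> complex" and s assume h: "h \<in> linf"
  have "representer (\<lambda>t. f t * h t) s = representer (\<lambda>t. (f t - f s) * h t + f s * h t) s" by (simp add: algebra_simps)
  also have "\<dots> = representer (\<lambda>t. (f t - f s) * h t) s + f s * representer h s"
    using h f by (subst representer_add) (auto intro!: linf_mult linf_diff linf_const simp: representer_scale)
  finally show "representer (\<lambda>t. f t * h t) s = f s * representer h s" using assms(2)[OF h] by simp
qed

text \<open>By \<open>multiplierI\<close> it suffices that the representer of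
  \<open>u = (f - f s) * h\<close> vanishes at \<open>s\<close>. Here \<open>u = v + W * k\<close>,
  with \<open>v\<close> uniformly small and \<open>W\<close> a sum of squares
  \<open>|g - g s|^2\<close>; the second summand has a representer vanishing at
  \<open>s\<close>.\<close>

lemma weakly_continuous_multiplier:
  assumes f: "f \<in> linf" and cont: "weakly_continuous E f"
  shows "multiplier f"
proof (rule multiplierI[OF f])
  fix h :: "'s \<Rightarrow> complex" and s assume h: "h \<in> linf"
  obtain K where K: "K > 0"
    "\<And>h \<epsilon> s. \<epsilon> > 0 \<Longrightarrow> (\<And>t. cmod (h t) \<le> \<epsilon>) \<Longrightarrow> cmod (representer h s) \<le> K * \<epsilon>"
    using representer_bound by blast
  define u where "u t = (f t - f s) * h t" for t
  have u: "u \<in> linf" unfolding u_def using f h by (intro linf_mult linf_diff linf_const)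
  \<comment> \<open>Adding 1 keeps \<open>H\<close> positive even when \<open>h\<close> is zero, so
    that the tolerance \<open>\<epsilon> / (K * H)\<close> is meaningful.\<close>
  define H where "H = sup_norm h + 1"
  have H: "H > 0" "cmod (h t) \<le> H" for t
    using sup_norm_nonneg[OF h] norm_le_sup_norm[OF h, of t] by (simp_all add: H_def)
  have le: "cmod (representer u s) \<le> \<epsilon>" if \<epsilon>: "\<epsilon> > 0" for \<epsilon>
  proof -
    have "\<epsilon> / (K * H) > 0" using \<epsilon> K H by simp
    then obtain G where G: "finite G" "G \<subseteq> E"
      and near: "\<And>t. (\<forall>g\<in>G. cmod (g t - g s) < 1) \<Longrightarrow> cmod (f t - f s) < \<epsilon> / (K * H)"
      using cont unfolding weakly_continuous_def by meson
    define N where "N = {t. \<forall>g\<in>G. cmod (g t - g s) < 1}"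
    define W where "W t = (\<Sum>g\<in>G. cnj (g t - g s) * (g t - g s))" for t
    have W_real: "W t = of_real (\<Sum>g\<in>G. (cmod (g t - g s))\<^sup>2)" for t
      by (simp add: W_def complex_norm_square mult.commute del: of_real_power complex_cnj_diff)
    have W_ge: "1 \<le> cmod (W t)" if t: "t \<notin> N" for t
    proof -
      obtain g where g: "g \<in> G" "1 \<le> cmod (g t - g s)" using t by (force simp: N_def)
      have "1 \<le> (cmod (g t - g s))\<^sup>2" using g by simp
      also have "\<dots> \<le> (\<Sum>g\<in>G. (cmod (g t - g s))\<^sup>2)" using G g by (intro member_le_sum) auto
      finally show ?thesis unfolding W_real norm_of_real by simp
    qed
    define k where "k t = (if t \<in> N then 0 else u t / W t)" for t
    have k: "k \<in> linf"
    proof (rule linfI)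
      show "cmod (k t) \<le> sup_norm u" for t
      proof (cases "t \<in> N")
        case False
        then have "cmod (u t) / cmod (W t) \<le> cmod (u t) / 1"
          using W_ge[OF False] by (intro divide_left_mono) auto
        then show ?thesis using norm_le_sup_norm[OF u, of t] False by (simp add: k_def norm_divide)
      qed (use sup_norm_nonneg[OF u] in \<open>simp add: k_def\<close>)
    qed
    define v where "v t = (if t \<in> N then u t else 0)" for t
    have v_le: "cmod (v t) \<le> \<epsilon> / K" for t
    proof (cases "t \<in> N")
      case True
      then have "cmod (f t - f s) \<le> \<epsilon> / (K * H)" using near[of t] by (simp add: N_def)
      then have "cmod (f t - f s) * cmod (h t) \<le> \<epsilon> / (K * H) * H"
        using H \<epsilon> K(1) by (intro mult_mono) auto
      then show ?thesis using H(1) True by (simp add: v_def u_def norm_mult)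
    qed (use \<epsilon> K in \<open>simp add: v_def\<close>)
    have Gl: "(\<lambda>t. cnj (g t - g s) * k t) \<in> linf" "(\<lambda>t. g t - g s) \<in> linf" if "g \<in> G" for g
      using that G k E_bounded by (auto intro!: linf_mult linf_cnj linf_diff linf_const simp del: complex_cnj_diff)
    \<comment> \<open>Conjugates are not yet known to lie in \<open>E\<close>, so
      \<open>cnj (g t - g s)\<close> is absorbed into the bounded factor \<open>l\<close>, and only
      \<open>g\<close> is moved across \<open>representer\<close>.\<close>
    have "representer (\<lambda>t. (g t - g s) * (cnj (g t - g s) * k t)) s = 0" if g: "g \<in> G" for g
    proof -
      define l where "l = (\<lambda>t. cnj (g t - g s) * k t)"
      have l: "l \<in> linf" unfolding l_def by (rule Gl(1)[OF g])
      have gE: "g \<in> E" using g G by auto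
      have "representer (\<lambda>t. (g t - g s) * l t) s = representer (\<lambda>t. g t * l t + (- g s) * l t) s"
        by (simp add: algebra_simps)
      also have "\<dots> = representer (\<lambda>t. g t * l t) s + representer (\<lambda>t. (- g s) * l t) s"
        by (subst representer_add[OF linf_mult[OF E_bounded[OF gE] l] linf_scale[OF l]]) (rule refl)
      also have "\<dots> = 0" by (simp only: representer_mult[OF l gE] representer_scale[OF l]) simp
      finally show ?thesis by (simp only: l_def)
    qed
    moreover have "(\<lambda>t. W t * k t) = (\<lambda>t. \<Sum>g\<in>G. (g t - g s) * (cnj (g t - g s) * k t))"
      by (simp add: W_def sum_distrib_left mult_ac)
    moreover have "representer \<dots> = (\<lambda>r. \<Sum>g\<in>G. representer (\<lambda>t. (g t - g s) * (cnj (g t - g s) * k t)) r)"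
      by (intro representer_sum linf_mult[OF Gl(2) Gl(1)])
    ultimately have "representer (\<lambda>t. W t * k t) s = 0" by simp
    moreover have "u = (\<lambda>t. v t + W t * k t)" using W_ge by (force simp: v_def k_def)
    moreover have "v \<in> linf" using v_le by (rule linfI)
    moreover have "W \<in> linf" unfolding W_def using Gl k G E_bounded
      by (auto intro!: linf_sum linf_mult linf_cnj linf_diff linf_const simp del: complex_cnj_diff)
    ultimately have "representer u s = representer v s" using representer_add[OF _ linf_mult[OF _ k], of v W] by simp
    then show ?thesis using K(2)[of "\<epsilon> / K" v s] v_le \<epsilon> K(1) by simp
  qed
  then have "cmod (representer u s) \<le> 0" by (rule field_le_epsilon) simp
  then show "representer (\<lambda>t. (f t - f s) * h t) s = 0" by (simp add: u_def[abs_def])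
qed

text \<open>Conjugation preserves distances, so the single test function
  \<open>f / \<epsilon>\<close> suffices. Conjugates of members of \<open>E\<close> thereby become
  multipliers before \<open>E\<close> is known to be self-adjoint.\<close>

lemma weakly_continuous_cnj:
  assumes f: "f \<in> E" shows "weakly_continuous E (\<lambda>t. cnj (f t))"
  unfolding weakly_continuous_def
proof (intro allI impI)
  fix s and \<epsilon> :: real assume \<epsilon>: "\<epsilon> > 0"
  define g where "g t = of_real (1 / \<epsilon>) * f t" for t
  have g: "g \<in> E" unfolding g_def by (rule E_scale[OF f])
  have "cmod (cnj (f t) - cnj (f s)) < \<epsilon>" if "cmod (g t - g s) < 1" for t
  proof -
    have "1 / \<epsilon> * cmod (f t - f s) < 1"
      using that \<epsilon> unfolding g_def right_diff_distrib[symmetric] norm_mult norm_of_real by simp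
    then show ?thesis using \<epsilon> by (simp flip: complex_cnj_diff)
  qed
  then show "\<exists>G. finite G \<and> G \<subseteq> E \<and>
     (\<forall>t. (\<forall>g\<in>G. cmod (g t - g s) < 1) \<longrightarrow> cmod (cnj (f t) - cnj (f s)) < \<epsilon>)"
    using g by (intro exI[of _ "{g}"]) auto
qed

text \<open>The functions \<open>u n = f * (1 - P) ^ n\<close> all have the same value under
  \<open>\<Lambda>\<close>, because a multiplier times a member of \<open>E\<close> is annihilated.
  Since \<open>P\<close> is bounded below where \<open>f\<close> is large, \<open>u n\<close>
  becomes uniformly small.\<close>

lemma \<Lambda>_vanishing:
  assumes f: "multiplier f" and van: "vanishing_at_infinity E f"
  shows "\<Lambda> f = 0"
proof -
  have fl: "f \<in> linf" by (rule multiplier_linf[OF f])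
  have le: "cmod (\<Lambda> f) \<le> \<delta>" if \<delta>: "\<delta> > 0" for \<delta>
  proof -
    \<comment> \<open>Halving compensates the constant 2 in \<open>\<Lambda>_bound\<close>.\<close>
    define \<epsilon> where "\<epsilon> = \<delta> / 2"
    have \<epsilon>: "\<epsilon> > 0" using \<delta> by (simp add: \<epsilon>_def)
    then obtain G where G: "finite G" "G \<subseteq> E"
      and large: "\<And>t. \<epsilon> \<le> cmod (f t) \<Longrightarrow> \<exists>g\<in>G. 1 \<le> cmod (g t)"
      using van unfolding vanishing_at_infinity_def by meson
    have G_linf: "g \<in> linf" if "g \<in> G" for g using that G E_bounded by auto
    \<comment> \<open>This factor keeps \<open>P\<close> between 0 and 1; the added 1 makes the
      denominator positive and gives \<open>\<alpha> \<le> 1\<close>.\<close>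
    define \<alpha> where "\<alpha> = 1 / (1 + (\<Sum>g\<in>G. (sup_norm g)\<^sup>2))"
    have \<alpha>: "0 < \<alpha>" "\<alpha> \<le> 1"
      using sum_nonneg[of G "\<lambda>g. (sup_norm g)\<^sup>2"] by (auto simp: \<alpha>_def add_pos_nonneg)
    define R where "R t = \<alpha> * (\<Sum>g\<in>G. (cmod (g t))\<^sup>2)" for t
    define P where "P t = (\<Sum>g\<in>G. of_real \<alpha> * cnj (g t) * g t)" for t
    have P_real: "P t = of_real (R t)" for t
      by (simp add: P_def R_def complex_norm_square sum_distrib_left mult_ac del: of_real_power)
    have R_le: "0 \<le> R t" "R t \<le> 1" for t
    proof -
      show "0 \<le> R t" using \<alpha> by (simp add: R_def sum_nonneg)
      have "(\<Sum>g\<in>G. (cmod (g t))\<^sup>2) \<le> (\<Sum>g\<in>G. (sup_norm g)\<^sup>2)"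
        using G_linf by (intro sum_mono power_mono norm_le_sup_norm) auto
      then show "R t \<le> 1" using sum_nonneg[of G "\<lambda>g. (sup_norm g)\<^sup>2"] by (simp add: R_def \<alpha>_def divide_simps)
    qed
    have R_ge: "\<alpha> \<le> R t" if t: "\<epsilon> \<le> cmod (f t)" for t
    proof -
      obtain g where g: "g \<in> G" "1 \<le> cmod (g t)" using large[OF t] by auto
      have "1 \<le> (cmod (g t))\<^sup>2" using g by simp
      also have "\<dots> \<le> (\<Sum>g\<in>G. (cmod (g t))\<^sup>2)" using G g by (intro member_le_sum) auto
      finally show ?thesis using \<alpha> by (simp add: R_def)
    qed
    define u where "u n t = f t * (1 + of_real (-1) * P t) ^ n" for n t
    have cnj_mult: "multiplier (\<lambda>t. cnj (g t))" if "g \<in> G" for g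
      using that G G_linf by (intro weakly_continuous_multiplier weakly_continuous_cnj linf_cnj) auto
    have g_mult: "multiplier g" if "g \<in> G" for g
      using that G G_linf by (auto simp: multiplier_def representer_mult)
    have u_mult: "multiplier (u n)" for n
      unfolding u_def P_def
      by (intro multiplier_mult multiplier_power multiplier_add multiplier_const multiplier_sum f cnj_mult g_mult)
    \<comment> \<open>\<open>u n - u (Suc n) = u n * P\<close> is a sum of products of multipliers with members of \<open>E\<close>.\<close>
    have step: "\<Lambda> (u (Suc n)) = \<Lambda> (u n)" for n
    proof -
      define F where "F g t = (of_real \<alpha> * cnj (g t) * u n t) * g t" for g t
      have m: "multiplier (\<lambda>t. of_real \<alpha> * cnj (g t) * u n t)" if "g \<in> G" for g
        using that by (intro multiplier_mult multiplier_const u_mult cnj_mult)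
      have F: "\<Lambda> (F g) = 0" if g: "g \<in> G" for g
      proof -
        have "\<Lambda> (F g) = pairing g (representer (\<lambda>t. of_real \<alpha> * cnj (g t) * u n t))"
          unfolding F_def using g G by (intro \<Lambda>_mult multiplier_linf m) auto
        then show ?thesis by (simp add: representer_multiplier_zero[OF m[OF g]] pairing_zero)
      qed
      have F_linf: "F g \<in> linf" if "g \<in> G" for g
        unfolding F_def using that by (intro linf_mult[OF multiplier_linf[OF m]] G_linf)
      have "(\<Sum>g\<in>G. F g t) = u n t * P t" for t
        by (simp add: F_def P_def sum_distrib_left mult_ac)
      then have u_Suc: "u (Suc n) = (\<lambda>t. u n t + (-1) * (\<Sum>g\<in>G. F g t))"
        by (intro ext) (simp add: u_def algebra_simps)
      have "\<Lambda> (u (Suc n)) = \<Lambda> (\<lambda>t. u n t + (-1) * (\<Sum>g\<in>G. F g t))" by (simp only: u_Suc)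
      also have "\<dots> = \<Lambda> (u n) + (-1) * (\<Sum>g\<in>G. \<Lambda> (F g))"
        by (simp only: \<Lambda>_add[OF multiplier_linf[OF u_mult] linf_scale[OF linf_sum]]
            \<Lambda>_scale[OF linf_sum] \<Lambda>_sum F_linf)
      finally show ?thesis using F by simp
    qed
    have "u 0 = f" by (intro ext) (simp add: u_def)
    then have "\<Lambda> (u n) = \<Lambda> f" for n
      by (induction n) (simp_all add: step)
    moreover obtain n where n: "sup_norm f * (1 - \<alpha>) ^ n \<le> \<epsilon>"
    proof -
      have "(\<lambda>n. sup_norm f * (1 - \<alpha>) ^ n) \<longlonglongrightarrow> sup_norm f * 0"
        using \<alpha> by (intro tendsto_mult tendsto_const LIMSEQ_power_zero) auto
      then have "\<forall>\<^sub>F n in sequentially. sup_norm f * (1 - \<alpha>) ^ n < \<epsilon>"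
        using \<epsilon> by (intro order_tendstoD(2)) auto
      then show ?thesis using that by (auto simp: eventually_sequentially intro: less_imp_le)
    qed
    \<comment> \<open>Where \<open>f\<close> is at least \<open>\<epsilon>\<close> in modulus, the
      power decays at rate \<open>1 - \<alpha>\<close>; elsewhere it is at most 1 and
      \<open>f\<close> is already small.\<close>
    moreover have "sup_norm (u n) \<le> \<epsilon>"
    proof (rule sup_norm_le)
      fix t
      have "1 + of_real (-1) * P t = complex_of_real (1 - R t)" by (simp add: P_real)
      then have "cmod (u n t) = cmod (f t) * \<bar>1 - R t\<bar> ^ n"
        by (simp only: u_def norm_mult norm_power norm_of_real)
      then have u: "cmod (u n t) = cmod (f t) * (1 - R t) ^ n"
        using R_le(2)[of t] by simp
      show "cmod (u n t) \<le> \<epsilon>"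
      proof (cases "\<epsilon> \<le> cmod (f t)")
        case True
        have "cmod (f t) * (1 - R t) ^ n \<le> sup_norm f * (1 - \<alpha>) ^ n"
          using R_ge[OF True] R_le[of t] norm_le_sup_norm[OF fl] sup_norm_nonneg[OF fl]
          by (intro mult_mono power_mono) auto
        then show ?thesis using u n by simp
      next
        case False
        have "cmod (f t) * (1 - R t) ^ n \<le> \<epsilon> * 1"
          using False R_le[of t] \<epsilon> by (intro mult_mono power_le_one) auto
        then show ?thesis using u by simp
      qed
    qed
    ultimately show ?thesis using \<Lambda>_bound[OF multiplier_linf[OF u_mult], of n] by (simp add: \<epsilon>_def)
  qed
  then have "cmod (\<Lambda> f) \<le> 0" by (rule field_le_epsilon) simp
  then show ?thesis by simp
qed

end

section \<open>Membership criterion and Lipschitz functional calculus\<close>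

context hopf_predual
begin

text \<open>Otherwise \<open>f\<close> has positive distance from the closed subspace
  \<open>E\<close>, and Hahn-Banach yields a functional that annihilates \<open>E\<close> but not
  \<open>f\<close>, contradicting \<open>\<Lambda>_vanishing\<close>.\<close>

theorem mem_predualI:
  assumes f: "f \<in> linf" and "weakly_continuous E f" "vanishing_at_infinity E f"
  shows "f \<in> E"
proof (rule ccontr)
  assume "f \<notin> E"
  interpret l: Metric_space "linf :: ('s \<Rightarrow> complex) set" "norm_dist linf sup_norm"
    by (rule Metric_space_linf)
  obtain d where d: "d > 0" "disjnt E (l.mball f d)"
    using E_closed \<open>f \<notin> E\<close> f unfolding norm_topology_def l.closedin_metric by blast
  have dist: "d \<le> sup_norm (\<lambda>s. f s - e s)" if "e \<in> E" for e
  proof -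
    have "e \<notin> l.mball f d" using d that by (auto simp: disjnt_def)
    then show ?thesis using f E_bounded[OF that] by (simp add: norm_dist_def)
  qed
  obtain \<Lambda> where \<Lambda>: "complex_linear_on linf \<Lambda>" "\<And>x. x \<in> linf \<Longrightarrow> cmod (\<Lambda> x) \<le> 2 * sup_norm x"
    "\<And>e. e \<in> E \<Longrightarrow> \<Lambda> e = 0" "\<Lambda> f \<noteq> 0"
    by (rule separating_functional[OF E_linf E_subspace f d(1) dist]) (assumption, rule that)
  then interpret annihilating_functional E \<Lambda> by unfold_locales auto
  show False using \<Lambda>(4) \<Lambda>_vanishing weakly_continuous_multiplier assms by blast
qed

text \<open>Both conditions of \<open>mem_predualI\<close> pass from \<open>f\<close> to its
  composite with \<Phi>, tested by the single function \<open>(L / \<epsilon>) * f\<close>. The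
  estimates concern values of \<open>f\<close> only, which admits functions such as
  \<open>z / (1 - z)\<close> on a smaller disc.\<close>

lemma lipschitz_mem:
  assumes f: "f \<in> E" and L: "L > 0" and lip: "\<And>s t. cmod (\<Phi> (f t) - \<Phi> (f s)) \<le> L * cmod (f t - f s)"
    and le: "\<And>t. cmod (\<Phi> (f t)) \<le> L * cmod (f t)"
  shows "(\<lambda>t. \<Phi> (f t)) \<in> E"
proof (rule mem_predualI)
  show "(\<lambda>t. \<Phi> (f t)) \<in> linf"
  proof (rule linfI)
    show "cmod (\<Phi> (f t)) \<le> L * sup_norm f" for t
      using le[of t] L norm_le_sup_norm[OF E_bounded[OF f], of t] by (meson mult_left_mono less_imp_le order_trans)
  qed
  show "weakly_continuous E (\<lambda>t. \<Phi> (f t))"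
    unfolding weakly_continuous_def
  proof (intro allI impI)
    fix s and \<epsilon> :: real assume \<epsilon>: "\<epsilon> > 0"
    define g where "g t = of_real (L / \<epsilon>) * f t" for t
    have g: "g \<in> E" unfolding g_def by (rule E_scale[OF f])
    have "cmod (\<Phi> (f t) - \<Phi> (f s)) < \<epsilon>" if "cmod (g t - g s) < 1" for t
    proof -
      have "L / \<epsilon> * cmod (f t - f s) < 1"
        using that L \<epsilon> unfolding g_def right_diff_distrib[symmetric] norm_mult norm_of_real by simp
      then have "L * cmod (f t - f s) < \<epsilon>" using \<epsilon> by (simp add: field_simps)
      then show ?thesis using lip[of t s] by simp
    qed
    then show "\<exists>G. finite G \<and> G \<subseteq> E \<and>
       (\<forall>t. (\<forall>g\<in>G. cmod (g t - g s) < 1) \<longrightarrow> cmod (\<Phi> (f t) - \<Phi> (f s)) < \<epsilon>)"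
      using g by (intro exI[of _ "{g}"]) auto
  qed
  show "vanishing_at_infinity E (\<lambda>t. \<Phi> (f t))"
    unfolding vanishing_at_infinity_def
  proof (intro allI impI)
    fix \<epsilon> :: real assume \<epsilon>: "\<epsilon> > 0"
    define g where "g t = of_real (L / \<epsilon>) * f t" for t
    have g: "g \<in> E" unfolding g_def by (rule E_scale[OF f])
    have "1 \<le> cmod (g t)" if "\<epsilon> \<le> cmod (\<Phi> (f t))" for t
    proof -
      have "\<epsilon> \<le> L * cmod (f t)" using that le[of t] by simp
      then show ?thesis using \<epsilon> L unfolding g_def norm_mult norm_of_real by (simp add: field_simps)
    qed
    then show "\<exists>G. finite G \<and> G \<subseteq> E \<and> (\<forall>t. \<epsilon> \<le> cmod (\<Phi> (f t)) \<longrightarrow> (\<exists>g\<in>G. 1 \<le> cmod (g t)))"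
      using g by (intro exI[of _ "{g}"]) auto
  qed
qed

lemma E_cnj: "f \<in> E \<Longrightarrow> (\<lambda>t. cnj (f t)) \<in> E"
  by (rule lipschitz_mem[of f 1]) (auto simp flip: complex_cnj_diff)

text \<open>On the disc of radius \<open>r\<close>, the function \<open>z / (1 - z)\<close> is
  Lipschitz with constant \<open>1 / (1 - r)^2\<close>. This supplies the quasi-inverses used to
  bound characters.\<close>

lemma E_geometric:
  assumes f: "f \<in> E" and r: "r < 1" and le: "\<And>t. cmod (f t) \<le> r"
  shows "(\<lambda>t. f t / (1 - f t)) \<in> E"
proof (rule lipschitz_mem[OF f])
  have d: "1 - r \<le> cmod (1 - f t)" for t
    using norm_triangle_ineq2[of 1 "f t"] le[of t] by simp
  have d0: "f t \<noteq> 1" for t using d[of t] r by auto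
  have r0: "0 \<le> r" using le norm_ge_zero order_trans by blast
  show "1 / (1 - r)\<^sup>2 > 0" using r by simp
  show "cmod (f t / (1 - f t) - f s / (1 - f s)) \<le> 1 / (1 - r)\<^sup>2 * cmod (f t - f s)" for s t
  proof -
    have "f t / (1 - f t) - f s / (1 - f s) = (f t - f s) / ((1 - f t) * (1 - f s))"
      using d0 by (simp add: field_simps)
    also have "cmod \<dots> \<le> cmod (f t - f s) / ((1 - r) * (1 - r))"
      unfolding norm_divide norm_mult using d r by (intro divide_left_mono mult_mono mult_pos_pos) (auto simp: d0)
    finally show ?thesis by (simp add: power2_eq_square)
  qed
  show "cmod (f t / (1 - f t)) \<le> 1 / (1 - r)\<^sup>2 * cmod (f t)" for t
  proof -
    \<comment> \<open>Lets the Lipschitz constant serve for the growth bound too.\<close>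
    have "(1 - r)\<^sup>2 \<le> 1 - r" using r r0 by (simp add: power2_eq_square mult_left_le)
    then have "(1 - r)\<^sup>2 \<le> cmod (1 - f t)" using d[of t] by simp
    then have "cmod (f t) / cmod (1 - f t) \<le> cmod (f t) / (1 - r)\<^sup>2"
      using r d0 by (intro divide_left_mono mult_pos_pos) auto
    then show ?thesis by (simp add: norm_divide)
  qed
qed

end

subsection \<open>The character space\<close>

context hopf_predual
begin

text \<open>If all of \<open>E\<close> vanished at \<open>s\<close>, the canonical map would send
  the nonzero unit vector at \<open>s\<close> to 0.\<close>

lemma nonvanishing: "\<exists>f\<in>E. f s \<noteq> 0"
proof (rule ccontr)
  assume "\<not> ?thesis"
  then have "unit_vec s = (\<lambda>t. 0)"
    by (intro ell1_eqI unit_vec_ell1 zero_ell1) (simp add: pairing_unit_vec pairing_zero)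
  then have "unit_vec s s = 0" by simp
  then show False by (simp add: unit_vec_def)
qed

lemma point_eval_character: "point_eval E s \<in> character_space E"
proof -
  obtain f where "f \<in> E" "f s \<noteq> 0" using nonvanishing by blast
  then show ?thesis
    by (auto simp: character_space_def point_eval_def complex_linear_on_def E_add E_scale E_mult)
qed

lemma inj_point_eval: "inj (point_eval E)"
proof (rule injI)
  fix s t assume eq: "point_eval E s = point_eval E t"
  have "f s = f t" if "f \<in> E" for f
    using fun_cong[OF eq, of f] that by (simp add: point_eval_def)
  then have "unit_vec s = unit_vec t"
    by (intro ell1_eqI unit_vec_ell1) (simp add: pairing_unit_vec)
  then have "unit_vec s s = unit_vec t s" by simp
  then show "s = t" by (simp add: unit_vec_def split: if_splits)
qed

lemma characterD:
  assumes "\<phi> \<in> character_space E"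
  shows "f \<in> E \<Longrightarrow> g \<in> E \<Longrightarrow> \<phi> (\<lambda>s. f s + g s) = \<phi> f + \<phi> g"
    and "f \<in> E \<Longrightarrow> \<phi> (\<lambda>s. c * f s) = c * \<phi> f"
    and "f \<in> E \<Longrightarrow> g \<in> E \<Longrightarrow> \<phi> (\<lambda>s. f s * g s) = \<phi> f * \<phi> g"
    and "\<phi> \<in> extensional E" and "\<exists>f\<in>E. \<phi> f \<noteq> 0"
  using assms by (auto simp: character_space_def complex_linear_on_def)

text \<open>Automatic continuity: \<open>character_space\<close> does not demand boundedness, but a
  character must be bounded to be represented in \<open>ell1\<close>. A violation is rescaled to
  \<open>\<phi> h = 1\<close> with \<open>h\<close> of supremum norm below 1.\<close>

lemma character_bound:
  assumes \<phi>: "\<phi> \<in> character_space E" and f: "f \<in> E" shows "cmod (\<phi> f) \<le> sup_norm f"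
proof (rule ccontr)
  assume "\<not> ?thesis"
  then have lt: "sup_norm f < cmod (\<phi> f)" by simp
  then have pos: "0 < cmod (\<phi> f)" using sup_norm_nonneg[OF E_bounded[OF f]] by linarith
  define h where "h = (\<lambda>t. inverse (\<phi> f) * f t)"
  have h: "h \<in> E" unfolding h_def by (rule E_scale[OF f])
  have \<phi>h: "\<phi> h = 1" unfolding h_def using characterD(2)[OF \<phi> f] pos by simp
  define r where "r = sup_norm f / cmod (\<phi> f)"
  have r: "r < 1" using lt pos by (simp add: r_def)
  have hr: "cmod (h t) \<le> r" for t
  proof -
    have "cmod (h t) = cmod (f t) / cmod (\<phi> f)"
      by (simp only: h_def norm_mult norm_inverse divide_inverse mult.commute)
    then show ?thesis
      using norm_le_sup_norm[OF E_bounded[OF f], of t] by (simp add: r_def divide_right_mono)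
  qed
  \<comment> \<open>The quasi-inverse \<open>g = h + h g\<close> is incompatible with \<open>\<phi> h = 1\<close>.\<close>
  define g where "g = (\<lambda>t. h t / (1 - h t))"
  have g: "g \<in> E" unfolding g_def by (rule E_geometric[OF h r hr])
  have "h t \<noteq> 1" for t using hr[of t] r by auto
  then have "g = (\<lambda>t. h t + h t * g t)" by (auto simp: g_def field_simps)
  then have "\<phi> g = \<phi> h + \<phi> h * \<phi> g"
    using characterD(1)[OF \<phi> h E_mult[OF h g]] characterD(3)[OF \<phi> h g] by simp
  then show False using \<phi>h by simp
qed

lemma character_is_point_eval:
  assumes \<phi>: "\<phi> \<in> character_space E"
  obtains s where "\<phi> = point_eval E s"
proof -
  have "\<phi> \<in> dual_space E"
    using \<phi> character_bound[OF \<phi>] unfolding dual_space_def character_space_def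
    by (auto intro: exI[of _ 1])
  then obtain a where a: "a \<in> ell1" and \<phi>a: "\<And>f. f \<in> E \<Longrightarrow> \<phi> f = pairing f a"
    by (rule dual_representer) blast
  have eq: "(\<lambda>s. g s * a s) = (\<lambda>s. \<phi> g * a s)" if g: "g \<in> E" for g
  proof (rule ell1_eqI)
    fix f assume f: "f \<in> E"
    have "pairing f (\<lambda>s. g s * a s) = \<phi> (\<lambda>s. g s * f s)"
      using f g by (simp add: \<phi>a E_mult pairing_mult)
    then show "pairing f (\<lambda>s. g s * a s) = pairing f (\<lambda>s. \<phi> g * a s)"
      using characterD(3)[OF \<phi> g f] f by (simp add: pairing_scale \<phi>a)
  qed (use a g in \<open>auto intro: ell1_mult ell1_scale E_bounded\<close>)
  obtain s where s: "a s \<noteq> 0"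
  proof (rule ccontr)
    assume "\<not> thesis"
    then have "a = (\<lambda>s. 0)" using that by auto
    then show False using characterD(5)[OF \<phi>] \<phi>a by (auto simp: pairing_zero)
  qed
  have "\<phi> g = g s" if "g \<in> E" for g using fun_cong[OF eq[OF that], of s] s by simp
  then have "\<phi> = point_eval E s"
    using characterD(4)[OF \<phi>] by (intro extensionalityI[of _ E]) (auto simp: point_eval_def)
  then show ?thesis by (rule that)
qed

lemma bij_point_eval: "bij_betw (point_eval E) UNIV (character_space E)"
  unfolding bij_betw_def
  using inj_point_eval point_eval_character by (auto elim: character_is_point_eval)

lemma inv_point_eval: "inv (point_eval E) (point_eval E s) = s"
  by (rule inv_f_f[OF inj_point_eval])

lemma point_eval_apply: "f \<in> E \<Longrightarrow> point_eval E s f = f s"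
  by (simp add: point_eval_def)

lemma char_mult_point_eval: "char_mult E (point_eval E s) (point_eval E t) = point_eval E (s * t)"
  by (simp add: char_mult_def inv_point_eval)

section \<open>Compactness in the Gelfand topology\<close>

lemma continuous_map_apply: "f \<in> E \<Longrightarrow> continuous_map (gelfand_topology E) euclidean (\<lambda>k. k f)"
  unfolding gelfand_topology_def
  by (intro continuous_map_from_subtopology continuous_map_product_projection)

lemma Hausdorff_gelfand: "Hausdorff_space (gelfand_topology E)"
  unfolding gelfand_topology_def
  by (intro Hausdorff_space_subtopology) (simp add: Hausdorff_space_product_topology)

text \<open>A Banach-Alaoglu argument: by \<open>character_bound\<close> the set lies in a product
  of closed discs, compact by Tychonoff, in which the algebraic identities and the lower bound at
  \<open>f\<close> define a closed subset.\<close>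

lemma compactin_superlevel:
  assumes f: "f \<in> E" and c: "c > 0"
  shows "compactin (gelfand_topology E) {k \<in> character_space E. c \<le> cmod (k f)}"
proof -
  let ?P = "product_topology (\<lambda>f. euclidean :: complex topology) E"
  let ?K = "PiE E (\<lambda>g. cball 0 (sup_norm g))"
  have proj: "continuous_map ?P euclidean (\<lambda>k. k g)" if "g \<in> E" for g
    using that continuous_map_product_projection[of g E "\<lambda>f. euclidean :: complex topology"] by simp
  have tendsto: "((\<lambda>k. k g) \<longlongrightarrow> k g) (atin ?P k)" if "g \<in> E" "k \<in> topspace ?P" for g k
    using proj[OF that(1)] that(2) by (simp add: continuous_map_atin limitin_canonical_iff)
  have add: "continuous_map ?P euclidean (\<lambda>k. k g + k h)"
    and mult: "continuous_map ?P euclidean (\<lambda>k. k g * k h)" if "g \<in> E" "h \<in> E" for g h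
    unfolding continuous_map_atin limitin_canonical_iff
    by (intro ballI tendsto_add tendsto_mult tendsto that; assumption)+
  have scale: "continuous_map ?P euclidean (\<lambda>k. c * k g)" if "g \<in> E" for g c
    unfolding continuous_map_atin limitin_canonical_iff
    by (intro ballI tendsto_mult tendsto_const tendsto that; assumption)
  have eq: "closedin ?P {k \<in> topspace ?P. u k = v k}"
    if "continuous_map ?P euclidean u" "continuous_map ?P euclidean v" for u v :: "_ \<Rightarrow> complex"
    by (rule closedin_continuous_maps_eq[OF _ that]) simp
  have Ball: "closedin ?P {k \<in> topspace ?P. \<forall>i\<in>I. Q i k}"
    if "\<And>i. i \<in> I \<Longrightarrow> closedin ?P {k \<in> topspace ?P. Q i k}" for I :: "'i set" and Q
  proof (cases "I = {}")
    case True
    then have "{k \<in> topspace ?P. \<forall>i\<in>I. Q i k} = topspace ?P" by blast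
    then show ?thesis by (simp only: closedin_topspace)
  next
    case False
    have "{k \<in> topspace ?P. \<forall>i\<in>I. Q i k} = (\<Inter>i\<in>I. {k \<in> topspace ?P. Q i k})" using False by auto
    then show ?thesis using False that by (simp add: closedin_INT)
  qed
  \<comment> \<open>Multiplicative functionals with \<open>c \<le> cmod (k f)\<close> are automatically nonzero, so no limit is lost.\<close>
  define Z where "Z = {k \<in> topspace ?P. \<forall>p\<in>E \<times> E. k (\<lambda>s. fst p s + snd p s) = k (fst p) + k (snd p)} \<inter>
    {k \<in> topspace ?P. \<forall>p\<in>UNIV \<times> E. k (\<lambda>s. fst p * snd p s) = fst p * k (snd p)} \<inter>
    {k \<in> topspace ?P. \<forall>p\<in>E \<times> E. k (\<lambda>s. fst p s * snd p s) = k (fst p) * k (snd p)} \<inter>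
    {k \<in> topspace ?P. k f \<in> {z. c \<le> cmod z}}"
  have "closedin ?P Z"
    unfolding Z_def
  proof (intro closedin_Int Ball eq)
    show "closedin ?P {k \<in> topspace ?P. k f \<in> {z. c \<le> cmod z}}"
      by (rule closedin_continuous_map_preimage[OF proj[OF f]]) (auto intro!: closed_Collect_le continuous_intros)
  qed (auto intro!: proj add mult scale E_add E_mult E_scale)
  moreover have "compactin ?P ?K" by (subst compactin_PiE) auto
  ultimately have "compactin ?P (?K \<inter> Z)" by (simp add: compact_Int_closedin)
  moreover have "?K \<inter> Z = {k \<in> character_space E. c \<le> cmod (k f)}"
  proof (intro equalityI subsetI)
    fix k assume k: "k \<in> ?K \<inter> Z"
    then have "k f \<noteq> 0" using c by (auto simp: Z_def)
    then show "k \<in> {k \<in> character_space E. c \<le> cmod (k f)}"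
      using k f by (auto simp: Z_def character_space_def complex_linear_on_def PiE_def)
  next
    fix k assume k: "k \<in> {k \<in> character_space E. c \<le> cmod (k f)}"
    then show "k \<in> ?K \<inter> Z"
      using characterD[of k] character_bound[of k]
      by (auto simp: Z_def PiE_def)
  qed
  ultimately show ?thesis
    unfolding gelfand_topology_def compactin_subtopology by auto
qed

text \<open>Every character is nonzero somewhere on \<open>E\<close>, so after rescaling the open
  sets \<open>1 < cmod (k g)\<close> cover. A finite subcover gives test functions of the kind used
  in \<open>vanishing_at_infinity\<close>.\<close>

lemma compactin_cover:
  assumes L: "compactin (gelfand_topology E) L"
  obtains G where "finite G" "G \<subseteq> E" "\<And>k. k \<in> L \<Longrightarrow> \<exists>g\<in>G. 1 \<le> cmod (k g)"
proof -
  define U where "U g = {k \<in> topspace (gelfand_topology E). k g \<in> {z. 1 < cmod z}}" for g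
  have "openin (gelfand_topology E) (U g)" if "g \<in> E" for g
    unfolding U_def by (rule openin_continuous_map_preimage[OF continuous_map_apply[OF that]])
      (auto intro!: open_Collect_less continuous_intros)
  moreover have "L \<subseteq> \<Union> (U ` E)"
  proof
    fix k assume "k \<in> L"
    then have k: "k \<in> character_space E"
      using compactin_subset_topspace[OF L] topspace_gelfand_topology by auto
    then obtain f where f: "f \<in> E" "k f \<noteq> 0" using characterD(5) by blast
    \<comment> \<open>The factor \<open>2 / k f\<close> makes the value at \<open>k\<close> equal to
      2, above the threshold.\<close>
    then have "k \<in> U (\<lambda>s. 2 / k f * f s)"
      using k characterD(2)[OF k f(1), of "2 / k f"] by (simp add: U_def topspace_gelfand_topology)
    then show "k \<in> \<Union> (U ` E)" using E_scale[OF f(1)] by blast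
  qed
  ultimately obtain \<F> where \<F>: "finite \<F>" "\<F> \<subseteq> U ` E" "L \<subseteq> \<Union>\<F>"
    using L unfolding compactin_def by (metis (no_types, lifting) imageE)
  then obtain G where G: "G \<subseteq> E" "finite G" "\<F> = U ` G" using finite_subset_image by metis
  show ?thesis
  proof
    show "\<exists>g\<in>G. 1 \<le> cmod (k g)" if "k \<in> L" for k
      using \<F>(3) that unfolding G(3) U_def by (fastforce intro: less_imp_le)
  qed (use G in auto)
qed

section \<open>Continuity and properness of translations\<close>

lemma E_sum: "(\<And>i. i \<in> I \<Longrightarrow> F i \<in> E) \<Longrightarrow> (\<lambda>s. \<Sum>i\<in>I. F i s) \<in> E"
  by (induction I rule: infinite_finite_induct) (auto intro: E_zero E_add)

text \<open>In the product topology it suffices to check coordinates, and each coordinate of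
  \<open>h\<close> is again evaluation at a member of \<open>E\<close>.\<close>

lemma translation_continuous:
  assumes h: "h ` character_space E \<subseteq> character_space E"
    and tr: "\<And>f. f \<in> E \<Longrightarrow> \<exists>f'\<in>E. \<forall>k\<in>character_space E. h k f = k f'"
  shows "continuous_map (gelfand_topology E) (gelfand_topology E) h"
proof -
  have "continuous_map (gelfand_topology E) (product_topology (\<lambda>f. euclidean) E) h"
    unfolding continuous_map_componentwise
  proof (intro conjI ballI)
    show "h ` topspace (gelfand_topology E) \<subseteq> extensional E"
      using h by (auto simp: topspace_gelfand_topology character_space_def)
    fix f assume "f \<in> E"
    then obtain f' where f': "f' \<in> E" "\<forall>k\<in>character_space E. h k f = k f'" using tr by blast
    show "continuous_map (gelfand_topology E) euclidean (\<lambda>k. h k f)"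
      by (rule continuous_map_eq[OF continuous_map_apply[OF f'(1)]])
        (use f' in \<open>auto simp: topspace_gelfand_topology\<close>)
  qed
  then show ?thesis
    using h by (subst gelfand_topology_def[of E]) (auto simp: continuous_map_in_subtopology topspace_gelfand_topology)
qed

text \<open>Self-adjointness of \<open>E\<close> combines a finite cover of \<open>L\<close> into
  one \<open>p = \<Sum> |g|^2\<close> in \<open>E\<close> with modulus at least 1 on
  \<open>L\<close>. The preimage of \<open>L\<close> is closed and lies in a compact superlevel set
  of \<open>p'\<close>.\<close>

lemma translation_proper:
  assumes h: "h ` character_space E \<subseteq> character_space E"
    and tr: "\<And>f. f \<in> E \<Longrightarrow> \<exists>f'\<in>E. \<forall>k\<in>character_space E. h k f = k f'"
    and L: "compactin (gelfand_topology E) L"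
  shows "compactin (gelfand_topology E) {k \<in> character_space E. h k \<in> L}"
proof -
  obtain G where G: "finite G" "G \<subseteq> E" and cover: "\<And>k. k \<in> L \<Longrightarrow> \<exists>g\<in>G. 1 \<le> cmod (k g)"
    using compactin_cover[OF L] by blast
  define p where "p = (\<lambda>t. \<Sum>g\<in>G. g t * cnj (g t))"
  have p: "p \<in> E" unfolding p_def using G by (intro E_sum E_mult E_cnj) auto
  then obtain p' where p': "p' \<in> E" "\<forall>k\<in>character_space E. h k p = k p'" using tr by blast
  have ge: "1 \<le> cmod (k p)" if k: "k \<in> L" for k
  proof -
    have "k \<in> character_space E"
      using k compactin_subset_topspace[OF L] topspace_gelfand_topology by auto
    then obtain s where s: "k = point_eval E s" by (rule character_is_point_eval)
    obtain g where g: "g \<in> G" "1 \<le> cmod (k g)" using cover[OF k] by blast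
    then have "1 \<le> (cmod (g s))\<^sup>2" using G by (auto simp: s point_eval_apply subset_iff)
    also have "\<dots> \<le> (\<Sum>g\<in>G. (cmod (g s))\<^sup>2)" using G g by (intro member_le_sum) auto
    also have "\<dots> = cmod (of_real (\<Sum>g\<in>G. (cmod (g s))\<^sup>2))"
      unfolding norm_of_real by (simp add: sum_nonneg)
    also have "of_real (\<Sum>g\<in>G. (cmod (g s))\<^sup>2) = p s"
      by (simp add: p_def complex_norm_square del: of_real_power)
    finally show ?thesis using p by (simp add: s point_eval_apply)
  qed
  show ?thesis
  proof (rule closed_compactin[OF compactin_superlevel[OF p'(1), of 1]])
    show "{k \<in> character_space E. h k \<in> L} \<subseteq> {k \<in> character_space E. 1 \<le> cmod (k p')}"
      using ge p'(2) by fastforce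
    show "closedin (gelfand_topology E) {k \<in> character_space E. h k \<in> L}"
      using closedin_continuous_map_preimage[OF translation_continuous[OF h tr]
          compactin_imp_closedin[OF Hausdorff_gelfand L]]
      by (simp add: topspace_gelfand_topology)
  qed simp
qed

lemma char_mult_left_translation:
  assumes "k \<in> character_space E"
  shows "char_mult E k ` character_space E \<subseteq> character_space E"
    and "f \<in> E \<Longrightarrow> \<exists>f'\<in>E. \<forall>l\<in>character_space E. char_mult E k l f = l f'"
proof -
  obtain s where s: "k = point_eval E s" using assms by (rule character_is_point_eval)
  show "char_mult E k ` character_space E \<subseteq> character_space E"
    by (auto simp: char_mult_def point_eval_character)
  assume f: "f \<in> E"
  have "char_mult E k l f = l (\<lambda>t. f (s * t))" if "l \<in> character_space E" for l
    using that f E_left_translate[OF f, of s]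
    by (auto simp: s char_mult_point_eval point_eval_apply elim!: character_is_point_eval)
  then show "\<exists>f'\<in>E. \<forall>l\<in>character_space E. char_mult E k l f = l f'"
    using E_left_translate[OF f] by blast
qed

lemma char_mult_right_translation:
  assumes "k \<in> character_space E"
  shows "(\<lambda>l. char_mult E l k) ` character_space E \<subseteq> character_space E"
    and "f \<in> E \<Longrightarrow> \<exists>f'\<in>E. \<forall>l\<in>character_space E. char_mult E l k f = l f'"
proof -
  obtain s where s: "k = point_eval E s" using assms by (rule character_is_point_eval)
  show "(\<lambda>l. char_mult E l k) ` character_space E \<subseteq> character_space E"
    by (auto simp: char_mult_def point_eval_character)
  assume f: "f \<in> E"
  have "char_mult E l k f = l (\<lambda>t. f (t * s))" if "l \<in> character_space E" for l
    using that f E_right_translate[OF f, of s]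
    by (auto simp: s char_mult_point_eval point_eval_apply elim!: character_is_point_eval)
  then show "\<exists>f'\<in>E. \<forall>l\<in>character_space E. char_mult E l k f = l f'"
    using E_right_translate[OF f] by blast
qed

lemma semitopological_character_space:
  "semitopological_semigroup (gelfand_topology E) (char_mult E)"
  unfolding semitopological_semigroup_def topspace_gelfand_topology
proof (intro conjI ballI)
  fix x y z assume x: "x \<in> character_space E" and y: "y \<in> character_space E" and z: "z \<in> character_space E"
  show "char_mult E (char_mult E x y) z = char_mult E x (char_mult E y z)"
    by (rule character_is_point_eval[OF x], rule character_is_point_eval[OF y],
        rule character_is_point_eval[OF z]) (simp add: char_mult_point_eval mult.assoc)
next
  fix x assume x: "x \<in> character_space E"
  show "continuous_map (gelfand_topology E) (gelfand_topology E) (char_mult E x)"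
    by (rule translation_continuous[OF char_mult_left_translation[OF x]])
  show "continuous_map (gelfand_topology E) (gelfand_topology E) (\<lambda>y. char_mult E y x)"
    by (rule translation_continuous[OF char_mult_right_translation[OF x]])
qed (auto simp: char_mult_def point_eval_character)

lemma cstar_subalgebra: "cstar_subalgebra E"
  by (auto simp: cstar_subalgebra_def E_bounded E_subspace E_closed E_mult E_cnj)

section \<open>Recovering the predual from its character space\<close>

lemma gelfand_neighbourhood:
  assumes W: "openin (gelfand_topology E) W" and s: "point_eval E s \<in> W"
  obtains G where "finite G" "G \<subseteq> E" "\<And>t. (\<forall>g\<in>G. cmod (g t - g s) < 1) \<Longrightarrow> point_eval E t \<in> W"
proof -
  obtain V where V: "openin (product_topology (\<lambda>f. euclidean :: complex topology) E) V"
    and WV: "W = V \<inter> character_space E"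
    using W unfolding gelfand_topology_def openin_subtopology by blast
  obtain U where U: "finite {i \<in> E. U i \<noteq> topspace (euclidean :: complex topology)}"
    "\<And>i. i \<in> E \<Longrightarrow> open (U i)" "point_eval E s \<in> PiE E U" "PiE E U \<subseteq> V"
    using V s unfolding WV openin_product_topology_alt by fastforce
  define J where "J = {i \<in> E. U i \<noteq> UNIV}"
  have "\<forall>i\<in>J. \<exists>d>0. ball (i s) d \<subseteq> U i"
  proof
    fix i assume "i \<in> J"
    then have "i \<in> E" by (simp add: J_def)
    then have "i s \<in> U i" using U(3) by (auto simp: PiE_def Pi_def point_eval_apply)
    then show "\<exists>d>0. ball (i s) d \<subseteq> U i" using U(2)[OF \<open>i \<in> E\<close>] open_contains_ball by blast
  qed
  then obtain d where d: "\<And>i. i \<in> J \<Longrightarrow> d i > 0" "\<And>i. i \<in> J \<Longrightarrow> ball (i s) (d i) \<subseteq> U i" by metis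
  \<comment> \<open>Scaling by \<open>1 / d i\<close> absorbs the radius into the test function,
    matching the threshold 1 of \<open>weakly_continuous\<close>.\<close>
  define G where "G = (\<lambda>i t. of_real (1 / d i) * i t) ` J"
  show ?thesis
  proof
    show "finite G" using U(1) by (simp add: G_def J_def)
    show "G \<subseteq> E" unfolding G_def J_def by (auto intro!: E_scale simp del: of_real_divide)
    fix t assume t: "\<forall>g\<in>G. cmod (g t - g s) < 1"
    have "i t \<in> U i" if i: "i \<in> E" for i
    proof (cases "i \<in> J")
      case True
      then have "cmod (of_real (1 / d i) * i t - of_real (1 / d i) * i s) < 1" using t by (auto simp: G_def)
      then have "1 / d i * cmod (i t - i s) < 1"
        using d(1)[OF True] unfolding right_diff_distrib[symmetric] norm_mult norm_of_real by simp
      then have "i t \<in> ball (i s) (d i)"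
        using d(1)[OF True] by (simp add: dist_norm norm_minus_commute field_simps)
      then show ?thesis using d(2)[OF True] by auto
    qed (use i in \<open>auto simp: J_def\<close>)
    then have "point_eval E t \<in> PiE E U" by (auto simp: point_eval_def)
    then show "point_eval E t \<in> W" using U(4) by (auto simp: WV point_eval_character)
  qed
qed

end

text \<open>\<open>\<theta>\<close> carries the open sets witnessing continuity of \<open>f\<close>
  and the compact sets witnessing its decay to the character space of \<open>F\<close>. Thus
  \<open>f\<close> satisfies the membership criterion for \<open>F\<close>.\<close>

lemma predual_subset_if_homeomorphic:
  assumes E: "hopf_predual E" and F: "hopf_predual F"
    and homeo: "homeomorphic_map (gelfand_topology E) (gelfand_topology F) \<theta>"
    and \<theta>: "\<And>s. \<theta> (point_eval E s) = point_eval F s"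
  shows "E \<subseteq> F"
proof
  interpret E: hopf_predual E by fact
  interpret F: hopf_predual F by fact
  fix f assume f: "f \<in> E"
  show "f \<in> F"
  proof (rule F.mem_predualI)
    show "f \<in> linf" by (rule E.E_bounded[OF f])
    show "weakly_continuous F f"
      unfolding weakly_continuous_def
    proof (intro allI impI)
      fix s and \<epsilon> :: real assume \<epsilon>: "\<epsilon> > 0"
      define U where "U = {k \<in> topspace (gelfand_topology E). k f \<in> ball (f s) \<epsilon>}"
      have "openin (gelfand_topology E) U"
        unfolding U_def by (rule openin_continuous_map_preimage[OF E.continuous_map_apply[OF f]]) simp
      then have "openin (gelfand_topology F) (\<theta> ` U)"
        using homeomorphic_imp_open_map[OF homeo] by (simp add: open_map_def)
      moreover have "point_eval E s \<in> U"
        using \<epsilon> f by (simp add: U_def topspace_gelfand_topology E.point_eval_character E.point_eval_apply)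
      then have "point_eval F s \<in> \<theta> ` U" using \<theta> by (metis imageI)
      ultimately obtain G where G: "finite G" "G \<subseteq> F"
        "\<And>t. (\<forall>g\<in>G. cmod (g t - g s) < 1) \<Longrightarrow> point_eval F t \<in> \<theta> ` U"
        by (rule F.gelfand_neighbourhood) (rule that)
      have "cmod (f t - f s) < \<epsilon>" if t: "\<forall>g\<in>G. cmod (g t - g s) < 1" for t
      proof -
        obtain k where k: "k \<in> U" "point_eval F t = \<theta> k" using G(3)[OF t] by blast
        then have "k \<in> character_space E" by (simp add: U_def topspace_gelfand_topology)
        then obtain r where r: "k = point_eval E r" by (rule E.character_is_point_eval)
        \<comment> \<open>The preimage under \<theta> is evaluation at some \<open>r\<close>;
          injectivity of evaluation on \<open>F\<close> identifies \<open>r\<close> with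
          \<open>t\<close>.\<close>
        have "t = r" using k(2) \<theta>[of r] F.inj_point_eval by (simp add: r inj_eq)
        then show ?thesis using k(1) f by (simp add: U_def r E.point_eval_apply dist_norm norm_minus_commute)
      qed
      then show "\<exists>G. finite G \<and> G \<subseteq> F \<and>
          (\<forall>t. (\<forall>g\<in>G. cmod (g t - g s) < 1) \<longrightarrow> cmod (f t - f s) < \<epsilon>)"
        using G by blast
    qed
    show "vanishing_at_infinity F f"
      unfolding vanishing_at_infinity_def
    proof (intro allI impI)
      fix \<epsilon> :: real assume \<epsilon>: "\<epsilon> > 0"
      let ?L = "{k \<in> character_space E. \<epsilon> \<le> cmod (k f)}"
      have "compactin (gelfand_topology F) (\<theta> ` ?L)"
        by (rule image_compactin[OF E.compactin_superlevel[OF f \<epsilon>] homeomorphic_imp_continuous_map[OF homeo]])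
      then obtain G where G: "finite G" "G \<subseteq> F" "\<And>k. k \<in> \<theta> ` ?L \<Longrightarrow> \<exists>g\<in>G. 1 \<le> cmod (k g)"
        by (rule F.compactin_cover) (rule that)
      have "\<exists>g\<in>G. 1 \<le> cmod (g t)" if "\<epsilon> \<le> cmod (f t)" for t
      proof -
        have "point_eval E t \<in> ?L" using that f by (simp add: E.point_eval_character E.point_eval_apply)
        from imageI[OF this, of \<theta>] have "point_eval F t \<in> \<theta> ` ?L" by (simp only: \<theta>)
        then obtain g where g: "g \<in> G" "1 \<le> cmod (point_eval F t g)" using G(3) by blast
        moreover have "g \<in> F" using g(1) G(2) by blast
        ultimately show ?thesis using F.point_eval_apply by auto
      qed
      then show "\<exists>G. finite G \<and> G \<subseteq> F \<and> (\<forall>t. \<epsilon> \<le> cmod (f t) \<longrightarrow> (\<exists>g\<in>G. 1 \<le> cmod (g t)))"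
        using G by blast
    qed
  qed
qed

theorem proposition2p2:
  fixes E :: "('s::semigroup_mult \<Rightarrow> complex) set"
  assumes "hopf_algebra_predual E"
  shows "cstar_subalgebra E \<and>
    bij_betw (point_eval E) UNIV (character_space E) \<and>
    semitopological_semigroup (gelfand_topology E) (char_mult E) \<and>
    (\<forall>s\<in>character_space E. \<forall>L. compactin (gelfand_topology E) L \<longrightarrow>
       compactin (gelfand_topology E) {t \<in> character_space E. char_mult E s t \<in> L} \<and>
       compactin (gelfand_topology E) {t \<in> character_space E. char_mult E t s \<in> L}) \<and>
    (\<forall>F. hopf_algebra_predual F \<longrightarrow>
       bij_betw (char_transfer E F) (character_space E) (character_space F) \<and>
       (\<forall>k\<in>character_space E. \<forall>l\<in>character_space E.
          char_transfer E F (char_mult E k l) =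
          char_mult F (char_transfer E F k) (char_transfer E F l)) \<and>
       (homeomorphic_map (gelfand_topology E) (gelfand_topology F) (char_transfer E F) \<longrightarrow> E = F))"
proof -
  interpret E: hopf_predual E by unfold_locales fact
  have proper: "compactin (gelfand_topology E) {t \<in> character_space E. char_mult E s t \<in> L}"
    "compactin (gelfand_topology E) {t \<in> character_space E. char_mult E t s \<in> L}"
    if s: "s \<in> character_space E" and L: "compactin (gelfand_topology E) L" for s L
    using E.translation_proper[OF E.char_mult_left_translation[OF s] L]
      E.translation_proper[OF E.char_mult_right_translation[OF s] L] by auto
  have transfer: "bij_betw (char_transfer E F) (character_space E) (character_space F) \<and>
       (\<forall>k\<in>character_space E. \<forall>l\<in>character_space E.
          char_transfer E F (char_mult E k l) =
          char_mult F (char_transfer E F k) (char_transfer E F l)) \<and>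
       (homeomorphic_map (gelfand_topology E) (gelfand_topology F) (char_transfer E F) \<longrightarrow> E = F)"
    if "hopf_algebra_predual F" for F :: "('s \<Rightarrow> complex) set"
  proof -
    interpret F: hopf_predual F by unfold_locales fact
    have eval: "char_transfer E F (point_eval E s) = point_eval F s" for s
      by (simp add: char_transfer_def E.inv_point_eval)
    have "bij_betw (char_transfer E F) (character_space E) (character_space F)"
      unfolding char_transfer_def
      by (rule bij_betw_trans[OF bij_betw_inv_into[OF E.bij_point_eval] F.bij_point_eval])
    moreover have "char_transfer E F (char_mult E k l) =
        char_mult F (char_transfer E F k) (char_transfer E F l)"
      if k: "k \<in> character_space E" and l: "l \<in> character_space E" for k l
      by (rule E.character_is_point_eval[OF k], rule E.character_is_point_eval[OF l])
        (simp add: eval E.char_mult_point_eval F.char_mult_point_eval)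
    moreover have "E = F"
      if homeo: "homeomorphic_map (gelfand_topology E) (gelfand_topology F) (char_transfer E F)"
    proof -
      \<comment> \<open>The inverse homeomorphism also matches evaluations at the same point, so the
        inclusion lemma applies in both directions.\<close>
      obtain \<theta> where "homeomorphic_maps (gelfand_topology E) (gelfand_topology F) (char_transfer E F) \<theta>"
        using homeo homeomorphic_map_maps by blast
      then have \<theta>: "homeomorphic_map (gelfand_topology F) (gelfand_topology E) \<theta>"
        "\<And>k. k \<in> character_space E \<Longrightarrow> \<theta> (char_transfer E F k) = k"
        by (auto simp: homeomorphic_maps_map topspace_gelfand_topology)
      have "\<theta> (point_eval F s) = point_eval E s" for s
        using \<theta>(2)[OF E.point_eval_character, of s] by (simp add: eval)
      then show ?thesis
        using predual_subset_if_homeomorphic[OF E.hopf_predual_axioms F.hopf_predual_axioms homeo eval]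
          predual_subset_if_homeomorphic[OF F.hopf_predual_axioms E.hopf_predual_axioms \<theta>(1)] by blast
    qed
    ultimately show ?thesis by blast
  qed
  show ?thesis
    using E.cstar_subalgebra E.bij_point_eval E.semitopological_character_space proper transfer
    by blast
qed

end
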